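(* Let $p\geq 2$ and let $G$ be a finite simple $\{pK_2, K_5-e\}$-free graph. Then $\chi(G)\leq f_p(\omega(G))$, where $f_p:\mathbb{N}\to\mathbb{N}$ ($p\geq2$) is defined as follows. First let $g_p$ ($p\geq2$) be given by $g_t(1)=1$ ($t\geq2$), $g_2(2)=3$, $g_2(m)=m$ ($m\geq3$), $g_p(2)=2p-2$ ($p\geq3$), $g_p(m)=g_{p-1}(m)+2m-2$ ($p,m\geq3$). Then $f_t(1)=1$ for $t\geq 2$; $f_2(2)=3$; $f_2(3)=4$; $f_2(4)=6$; $f_2(s)=s$ for $s\geq 5$; $f_p(2)=2p-2$ and $f_p(3)=2p^2-3p+4$ for $p\geq 3$; and $f_p(m)=f_{p-1}(m)+2g_{p-1}(m-1)+3m-6$ for $p\geq 3$, $m\geq 4$.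
   Context: $\chi(G)$ is the chromatic number and $\omega(G)$ the clique number of $G$. $pK_2$ is the disjoint union of $p$ edges; $K_5-e$ is the complete graph on five vertices minus one edge. A graph is $\mathcal{F}$-free if it has no induced subgraph isomorphic to a member of $\mathcal{F}$. *)

theory Defs
  imports "Graph_Theory.Graph_Theory"
begin

text \<open>
  A finite simple graph is a \<^locale>\<open>pair_graph\<close>: finite, loop-free and symmetric, so that an
  undirected edge between u and v is the pair of arcs (u,v) and (v,u).
\<close>

definition proper_coloring :: "'a pair_pre_digraph \<Rightarrow> nat \<Rightarrow> ('a \<Rightarrow> nat) \<Rightarrow> bool" where
  "proper_coloring G k c \<longleftrightarrow>
     (\<forall>v \<in> pverts G. c v < k) \<and> (\<forall>(u, v) \<in> parcs G. c u \<noteq> c v)"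

definition chromatic_number :: "'a pair_pre_digraph \<Rightarrow> nat" where
  "chromatic_number G = (LEAST k. \<exists>c. proper_coloring G k c)"

definition clique_in :: "'a pair_pre_digraph \<Rightarrow> 'a set \<Rightarrow> bool" where
  "clique_in G S \<longleftrightarrow> S \<subseteq> pverts G \<and> (\<forall>u \<in> S. \<forall>v \<in> S. u \<noteq> v \<longrightarrow> (u, v) \<in> parcs G)"

definition clique_number :: "'a pair_pre_digraph \<Rightarrow> nat" where
  "clique_number G = Max (card ` {S. clique_in G S})"

definition family_free :: "'b pair_pre_digraph set \<Rightarrow> 'a pair_pre_digraph \<Rightarrow> bool" where
  "family_free F G \<longleftrightarrow>
     \<not> (\<exists>H \<in> F. \<exists>K. induced_subgraph K (with_proj G) \<and> digraph_iso K (with_proj H))"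

text \<open>The edges of the disjoint union of p edges are the pairs {2i, 2i+1} for i < p.\<close>

definition pK2 :: "nat \<Rightarrow> nat pair_pre_digraph" where
  "pK2 p = \<lparr> pverts = {..<2 * p},
     parcs = {(u, v). u < 2 * p \<and> v < 2 * p \<and> u \<noteq> v \<and> u div 2 = v div 2} \<rparr>"

definition K5_minus_e :: "nat pair_pre_digraph" where
  "K5_minus_e = \<lparr> pverts = {..<5},
     parcs = {(u, v). u < 5 \<and> v < 5 \<and> u \<noteq> v} - {(0, 1), (1, 0)} \<rparr>"

text \<open>
  Only arguments p \<ge> 2 and m \<ge> 1 are meaningful for the two bounding functions below. The value 0
  at m = 0 is the one fitting the graph without vertices; the values at p < 2 are those at p = 2
  and are never used.
\<close>

fun gbound :: "nat \<Rightarrow> nat \<Rightarrow> nat" where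
  "gbound p m =
    (if m = 0 then 0
     else if m = 1 then 1
     else if p \<le> 2 then (if m = 2 then 3 else m)
     else if m = 2 then 2 * p - 2
     else gbound (p - 1) m + (2 * m - 2))"

fun fbound :: "nat \<Rightarrow> nat \<Rightarrow> nat" where
  "fbound p m =
    (if m = 0 then 0
     else if m = 1 then 1
     else if p \<le> 2 then (if m = 2 then 3 else if m = 3 then 4 else if m = 4 then 6 else m)
     else if m = 2 then 2 * p - 2
     else if m = 3 then 2 * p ^ 2 - 3 * p + 4
     else fbound (p - 1) m + 2 * gbound (p - 1) (m - 1) + (3 * m - 6))"

declare gbound.simps [simp del] fbound.simps [simp del]

lemma gbound_eqs:
  "gbound p 1 = 1"
  "gbound 2 2 = 3"
  "m \<ge> 3 \<Longrightarrow> gbound 2 m = m"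
  "p \<ge> 3 \<Longrightarrow> gbound p 2 = 2 * p - 2"
  "p \<ge> 3 \<Longrightarrow> m \<ge> 3 \<Longrightarrow> gbound p m = gbound (p - 1) m + 2 * m - 2"
  by (subst gbound.simps; simp)+

lemma fbound_eqs:
  "fbound p 1 = 1"
  "fbound 2 2 = 3"
  "fbound 2 3 = 4"
  "fbound 2 4 = 6"
  "m \<ge> 5 \<Longrightarrow> fbound 2 m = m"
  "p \<ge> 3 \<Longrightarrow> fbound p 2 = 2 * p - 2"
  "p \<ge> 3 \<Longrightarrow> int (fbound p 3) = 2 * int p ^ 2 - 3 * int p + 4"
  "p \<ge> 3 \<Longrightarrow> m \<ge> 4 \<Longrightarrow>
     fbound p m = fbound (p - 1) m + 2 * gbound (p - 1) (m - 1) + 3 * m - 6"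
proof -
  assume "p \<ge> 3"
  then have "3 * p \<le> 2 * p ^ 2" by (simp add: power2_eq_square)
  with \<open>p \<ge> 3\<close> show "int (fbound p 3) = 2 * int p ^ 2 - 3 * int p + 4"
    by (subst fbound.simps) (simp add: of_nat_diff)
qed (subst fbound.simps; simp)+

end

theory Submission
  imports Defs
begin

text \<open>
  Write A for the vertices adjacent to neither end of an edge xy; A contains one induced matching
  edge less than the whole graph. If xyz is a triangle, the vertices outside A are covered by the
  private neighbours of x missing yz, those of y missing xz, and the common neighbours of the three
  pairs; the former induce (p-1)K2-free diamond-free graphs, the latter disjoint unions of cliques.
  This gives the recursions of both bounds. The base cases that are not elementary are the
  4-colourability of 2K2-free K4-free graphs and of 3K2-free triangle-free graphs.

  Those two are proved for a vertex-critical counterexample by excluding small induced subgraphs H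
  one after the other. H is excluded in one of two ways: either the adjacencies of a vertex to H
  already determine a proper 4-colouring, because two vertices of equal colour cannot be adjacent
  without creating a subgraph excluded before; or some vertex u of H has its neighbourhood in H
  contained in that of a non-neighbour w, and every vertex adjacent to u but not to w would create
  such a subgraph. The sequence of subgraphs was found by computer search and is checked by
  rewriting.
\<close>

section \<open>Excluding induced subgraphs of critical graphs\<close>

text \<open>The small values fix the shape of the proof. Splitting off an edge of a triangle-free
  graph costs two colours, so \<open>gbound 2 2 = 3\<close> would give 5 for 3K2-free graphs, where
  only 4 are granted. A K4-free graph is automatically free of K5 - e, so that condition does not
  help towards \<open>fbound 2 3 = 4\<close>. Hence the two four-colour theorems. For larger cliques
  the 2K2-free case rests on a maximum clique K: a vertex outside sees at most d vertices of K, with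
  d = 1 for diamond-free and d = 2 for K5 - e free graphs, and two adjacent vertices outside cannot
  both miss an edge of K. If K has at least 2d + 2 vertices, the outside is therefore independent.
  The sizes just below, three and five, need a colouring by hand; size four with d = 2 takes one
  colour for each edge of K4, whence \<open>fbound 2 4 = 6\<close>. An obstacle in the induction is
  that 6 exceeds \<open>fbound 2 5 = 5\<close>: the vertices missing an edge may have a smaller
  clique number and yet a larger bound.\<close>

definition colorable :: "('a \<Rightarrow> 'a \<Rightarrow> bool) \<Rightarrow> 'a set \<Rightarrow> nat \<Rightarrow> bool" where
  "colorable E S k \<longleftrightarrow>
     (\<exists>c :: 'a \<Rightarrow> nat. (\<forall>v\<in>S. c v < k) \<and> (\<forall>u\<in>S. \<forall>v\<in>S. E u v \<longrightarrow> c u \<noteq> c v))"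

lemma list_all2_in_set_left: "list_all2 P xs ys \<Longrightarrow> x \<in> set xs \<Longrightarrow> \<exists>y. P x y"
  by (induction rule: list_all2_induct) auto

definition critical :: "('a \<Rightarrow> 'a \<Rightarrow> bool) \<Rightarrow> 'a set \<Rightarrow> nat \<Rightarrow> bool" where
  "critical E S k \<longleftrightarrow> \<not> colorable E S k \<and> (\<forall>v\<in>S. colorable E (S - {v}) k)"

text \<open>Otherwise a colouring of \<open>S - {u}\<close> extends to \<open>u\<close> by reusing
  the colour of \<open>w\<close>, since every neighbour of \<open>u\<close> is one of
  \<open>w\<close>.\<close>

lemma critical_not_comparable:
  assumes crit: "critical E S k" and sym: "\<And>x y. E x y \<Longrightarrow> E y x" and irr: "\<And>x. \<not> E x x"
    and u: "u \<in> S" and w: "w \<in> S" and neq: "u \<noteq> w" and nadj: "\<not> E u w"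
  shows "\<exists>x\<in>S. E u x \<and> \<not> E w x"
proof (rule ccontr)
  assume "\<not> ?thesis"
  then have sub: "\<And>x. x \<in> S \<Longrightarrow> E u x \<Longrightarrow> E w x" by blast
  from crit u obtain c :: "'a \<Rightarrow> nat" where
    c: "\<forall>v\<in>S - {u}. c v < k" "\<forall>x\<in>S - {u}. \<forall>y\<in>S - {u}. E x y \<longrightarrow> c x \<noteq> c y"
    unfolding critical_def colorable_def by blast
  let ?c = "c(u := c w)"
  have 1: "\<forall>v\<in>S. ?c v < k" using c(1) w neq by auto
  have 2: "?c x \<noteq> ?c y" if "x \<in> S" "y \<in> S" "E x y" for x y
  proof (cases "x = u")
    case True
    then have "y \<noteq> u" "E w y" using that irr sub by auto
    then have "c w \<noteq> c y" using c(2) that w neq by blast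
    then show ?thesis using True \<open>y \<noteq> u\<close> by simp
  next
    case False
    show ?thesis
    proof (cases "y = u")
      case True
      then have "E w x" using sub sym that by blast
      then have "c x \<noteq> c w" using c(2) that w neq False sym by blast
      then show ?thesis using True False by simp
    qed (use False c(2) that in auto)
  qed
  from 1 2 have "colorable E S k" unfolding colorable_def by blast
  then show False using crit unfolding critical_def by blast
qed

lemma not_colorable_imp_critical_subset:
  assumes "finite S" "\<not> colorable E S k"
  shows "\<exists>T\<subseteq>S. critical E T k"
  using assms
proof (induction S rule: finite_psubset_induct)
  case (psubset S)
  show ?case
  proof (cases "critical E S k")
    case False
    then obtain v where v: "v \<in> S" "\<not> colorable E (S - {v}) k"
      using psubset.prems unfolding critical_def by blast
    then have "S - {v} \<subset> S" by blast
    from psubset.IH[OF this v(2)] show ?thesis by blast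
  qed blast
qed

section \<open>Patterns, vertex types and certificates\<close>

text \<open>
  A pattern lists the vertices of a small graph, the latest one first; the row of a vertex says to
  which of the earlier vertices (again the latest first) it is adjacent.
\<close>

type_synonym pattern = "bool list list"

fun realizes :: "('a \<Rightarrow> 'a \<Rightarrow> bool) \<Rightarrow> 'a set \<Rightarrow> pattern \<Rightarrow> 'a list \<Rightarrow> bool" where
  "realizes E S [] vs \<longleftrightarrow> vs = []"
| "realizes E S (r # p) [] \<longleftrightarrow> False"
| "realizes E S (r # p) (v # vs) \<longleftrightarrow>
     v \<in> S \<and> v \<notin> set vs \<and> map (E v) vs = r \<and> realizes E S p vs"

definition occurs :: "('a \<Rightarrow> 'a \<Rightarrow> bool) \<Rightarrow> 'a set \<Rightarrow> pattern \<Rightarrow> bool" where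
  "occurs E S p \<longleftrightarrow> (\<exists>vs. realizes E S p vs)"

text \<open>The symmetric adjacency matrix, with \<open>False\<close> on the diagonal, that the
  triangular list of rows determines.\<close>

fun full_rows :: "pattern \<Rightarrow> bool list list" where
  "full_rows [] = []"
| "full_rows (r # p) = (False # r) # map2 (#) r (full_rows p)"

text \<open>A row doubles as a set of pattern vertices, namely a neighbourhood; these operations
  combine two such sets.\<close>

fun both :: "bool list \<Rightarrow> bool list \<Rightarrow> bool list" where
  "both (a # r) (b # s) = (a \<and> b) # both r s"
| "both _ _ = []"

fun neither :: "bool list \<Rightarrow> bool list \<Rightarrow> bool list" where
  "neither (a # r) (b # s) = (\<not> a \<and> \<not> b) # neither r s"
| "neither _ _ = []"

fun only_left :: "bool list \<Rightarrow> bool list \<Rightarrow> bool list" where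
  "only_left (a # r) (b # s) = (a \<and> \<not> b) # only_left r s"
| "only_left _ _ = []"

text \<open>
  Conditionals are used in place of disjunctions so that rewriting evaluates these tests lazily.
\<close>

fun some_both :: "bool list \<Rightarrow> bool list \<Rightarrow> bool" where
  "some_both (a # r) (b # s) = (if a \<and> b then True else some_both r s)"
| "some_both _ _ = False"

fun edge_in :: "pattern \<Rightarrow> bool list \<Rightarrow> bool" where
  "edge_in (r # p) (a # m) =
     (if a then if some_both r m then True else edge_in p m else edge_in p m)"
| "edge_in _ _ = False"

fun some_row :: "(bool list \<Rightarrow> bool) \<Rightarrow> bool list \<Rightarrow> bool list list \<Rightarrow> bool" where
  "some_row P (a # m) (r # rs) =
     (if a then if P r then True else some_row P m rs else some_row P m rs)"
| "some_row P _ _ = False"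

type_synonym row_test = "pattern \<Rightarrow> bool list \<Rightarrow> bool list \<Rightarrow> bool"

text \<open>The candidate rows of a vertex over a pattern, grown one pattern vertex at a time. A
  choice is pruned when adjacency (\<open>A\<close>) or non-adjacency (\<open>N\<close>) to the
  vertex just added completes a forbidden subgraph with the earlier ones. The resulting order is the
  one in which a certificate lists its labels.\<close>

fun row_types :: "row_test \<Rightarrow> row_test \<Rightarrow> pattern \<Rightarrow> bool list list" where
  "row_types A N [] = [[]]"
| "row_types A N (q # p) =
     concat (map (\<lambda>r. (if A p r q then [] else [True # r]) @ (if N p r q then [] else [False # r]))
       (row_types A N p))"

fun induces :: "bool list list \<Rightarrow> pattern \<Rightarrow> nat list \<Rightarrow> bool" where
  "induces R [] [] = True"
| "induces R (r # q) (j # js) = (if map (nth (R ! j)) js = r then induces R q js else False)"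
| "induces R _ _ = False"

definition witnessed :: "pattern list \<Rightarrow> pattern \<Rightarrow> nat \<times> nat list \<Rightarrow> bool" where
  "witnessed known p = (\<lambda>(k, js). k < length known \<and> distinct js \<and>
     list_all (\<lambda>j. j < length p) js \<and> induces (full_rows p) (known ! k) js)"

text \<open>
  A witness (k, js) points to the k-th pattern excluded so far and to the positions in the pattern
  at hand where it occurs. A row may also be that of a pattern vertex itself, in which case it does
  not yield a new vertex; hence the comparisons with the full rows below.
\<close>

datatype row_label = Colour bool bool | Excluded nat "nat list"

fun colored_rows :: "bool list list \<Rightarrow> row_label list \<Rightarrow> (bool list \<times> bool \<times> bool) list" where
  "colored_rows (r # rs) (Colour a b # ls) = (r, a, b) # colored_rows rs ls"
| "colored_rows (r # rs) (Excluded k js # ls) = colored_rows rs ls"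
| "colored_rows _ _ = []"

text \<open>A row is also paired with itself, as two vertices of the same type may be adjacent.
  Adjacency being symmetric, one order of each pair is enough.\<close>

fun conflicts :: "(bool list \<Rightarrow> bool list \<Rightarrow> bool) \<Rightarrow> (bool list \<times> bool \<times> bool) list \<Rightarrow>
    (bool list \<times> bool list) list" where
  "conflicts A [] = []"
| "conflicts A ((r, c) # rcs) =
     map (\<lambda>(s, d). (r, s)) (filter (\<lambda>(s, d). if d = c then \<not> A r s else False) ((r, c) # rcs))
     @ conflicts A rcs"

fun labels_ok :: "pattern list \<Rightarrow> pattern \<Rightarrow> bool list list \<Rightarrow> row_label list \<Rightarrow> bool" where
  "labels_ok known p [] [] = True"
| "labels_ok known p (r # rs) (Colour a b # ls) = labels_ok known p rs ls"
| "labels_ok known p (r # rs) (Excluded k js # ls) =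
     (r \<notin> set (full_rows p) \<and> witnessed known (r # p) (k, js) \<and> labels_ok known p rs ls)"
| "labels_ok known p _ _ = False"

text \<open>A graph containing the pattern would be coloured by vertex types: each candidate row has
  a colour or extends the pattern to something excluded, and for two rows of equal colour an edge
  between their vertices does so. The two \<open>some_row\<close> tests ensure that neither end of
  such an edge is a pattern vertex, so that both really extend the pattern.\<close>

definition static_ok :: "row_test \<Rightarrow> row_test \<Rightarrow> pattern list \<Rightarrow> pattern \<Rightarrow>
    row_label list \<Rightarrow> (nat \<times> nat list) list \<Rightarrow> bool" where
  "static_ok A N known p ls ws =
     (let R = full_rows p; T = row_types A N p in
      labels_ok known p T ls \<and>
      list_all2 (\<lambda>(r, s) w. \<not> some_row (\<lambda>t. t = r) s R \<and> \<not> some_row (\<lambda>t. t = s) r R \<and>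
          witnessed known ((True # s) # r # p) w)
        (conflicts (A p) (colored_rows T ls)) ws)"

text \<open>In a critical graph some vertex sees pattern vertex \<open>i\<close> but not
  \<open>j\<close>. It is a new vertex, because within the pattern the two neighbourhoods are
  nested; so each of its possible rows must lead to an excluded pattern.\<close>

definition compare_ok :: "row_test \<Rightarrow> row_test \<Rightarrow> pattern list \<Rightarrow> pattern \<Rightarrow>
    nat \<Rightarrow> nat \<Rightarrow> (nat \<times> nat list) list \<Rightarrow> bool" where
  "compare_ok A N known p i j ws =
     (let R = full_rows p in
      i < length p \<and> j < length p \<and> i \<noteq> j \<and> \<not> R ! i ! j \<and> list_all2 (\<longrightarrow>) (R ! i) (R ! j) \<and>
      list_all2 (\<lambda>r w. witnessed known (r # p) w)
        (filter (\<lambda>r. r ! i \<and> \<not> r ! j) (row_types A N p)) ws)"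

datatype justification =
    Static "row_label list" "(nat \<times> nat list) list"
  | Compare nat nat "(nat \<times> nat list) list"

fun justified :: "row_test \<Rightarrow> row_test \<Rightarrow> pattern list \<Rightarrow> pattern \<Rightarrow> justification \<Rightarrow> bool" where
  "justified A N known p (Static ls ws) = static_ok A N known p ls ws"
| "justified A N known p (Compare i j ws) = compare_ok A N known p i j ws"

text \<open>Excluded patterns are appended at the end, so starting from the empty list the number in
  a witness is the position of an earlier step.\<close>

fun refutes :: "row_test \<Rightarrow> row_test \<Rightarrow> pattern list \<Rightarrow> (pattern \<times> justification) list \<Rightarrow> bool" where
  "refutes A N known [] = True"
| "refutes A N known ((p, J) # steps) =
     (if justified A N known p J then refutes A N (known @ [p]) steps else False)"

section \<open>Soundness of the certificates\<close>

locale graph_rel =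
  fixes E :: "'a \<Rightarrow> 'a \<Rightarrow> bool"
  assumes sym: "E x y \<Longrightarrow> E y x" and irrefl: "\<not> E x x"
begin

lemma adj_commute: "E x y \<longleftrightarrow> E y x"
  using sym by blast

lemma realizes_length: "realizes E S p vs \<Longrightarrow> length vs = length p"
  by (induction E S p vs rule: realizes.induct) auto

lemma realizes_subset: "realizes E S p vs \<Longrightarrow> set vs \<subseteq> S"
  by (induction E S p vs rule: realizes.induct) auto

lemma realizes_distinct: "realizes E S p vs \<Longrightarrow> distinct vs"
  by (induction E S p vs rule: realizes.induct) auto

lemma full_rows_realizes:
  "realizes E S p vs \<Longrightarrow> full_rows p = map (\<lambda>v. map (E v) vs) vs"
proof (induction p arbitrary: vs)
  case (Cons r p)
  then obtain v us where vs: "vs = v # us" "map (E v) us = r" "realizes E S p us"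
    by (cases vs) auto
  have r: "r = map (\<lambda>x. E x v) us" unfolding vs(2)[symmetric] by (simp add: adj_commute[of v])
  show ?case
    unfolding vs(1) full_rows.simps Cons.IH[OF vs(3)]
    by (simp add: irrefl vs(2)) (simp add: r map2_map_map)
qed auto

lemma both_map: "both (map P vs) (map Q vs) = map (\<lambda>v. P v \<and> Q v) vs"
  by (induction vs) auto

lemma neither_map: "neither (map P vs) (map Q vs) = map (\<lambda>v. \<not> P v \<and> \<not> Q v) vs"
  by (induction vs) auto

lemma only_left_map: "only_left (map P vs) (map Q vs) = map (\<lambda>v. P v \<and> \<not> Q v) vs"
  by (induction vs) auto

lemma some_both_map: "some_both (map P vs) (map Q vs) \<longleftrightarrow> (\<exists>v\<in>set vs. P v \<and> Q v)"
  by (induction vs) auto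

lemma some_row_map: "some_row F (map P vs) (map G vs) \<longleftrightarrow> (\<exists>v\<in>set vs. P v \<and> F (G v))"
  by (induction vs) auto

lemma edge_in_realizes:
  "realizes E S p vs \<Longrightarrow> edge_in p (map P vs) \<Longrightarrow> \<exists>u\<in>set vs. \<exists>v\<in>set vs. E u v \<and> P u \<and> P v"
proof (induction p arbitrary: vs)
  case (Cons r p)
  then obtain v us where vs: "vs = v # us" "map (E v) us = r" "realizes E S p us"
    by (cases vs) auto
  from Cons.prems(2) have "P v \<and> some_both r (map P us) \<or> edge_in p (map P us)"
    by (auto simp: vs(1) split: if_splits)
  then show ?case
    using Cons.IH[OF vs(3)] by (auto simp: vs(1) vs(2)[symmetric] some_both_map)
qed auto

lemmas mask_simps = both_map neither_map only_left_map some_both_map some_row_map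

lemma realizes_induces:
  assumes vs: "realizes E S p vs" and "distinct js" "list_all (\<lambda>j. j < length p) js"
    and "induces (full_rows p) q js"
  shows "realizes E S q (map (nth vs) js)"
  using assms(2-)
proof (induction q arbitrary: js)
  case Nil
  then show ?case by (cases js) auto
next
  case (Cons r q)
  then obtain j js' where js: "js = j # js'" "map (nth (full_rows p ! j)) js' = r"
      "induces (full_rows p) q js'"
    by (cases js) (auto split: if_splits)
  have len: "length vs = length p" using realizes_length[OF vs] .
  have b: "j < length vs" "\<And>i. i \<in> set js' \<Longrightarrow> i < length vs"
    using Cons.prems by (auto simp: js(1) len list_all_iff)
  have "map (E (vs ! j)) (map ((!) vs) js') = r"
    unfolding js(2)[symmetric] full_rows_realizes[OF vs] using b by auto
  moreover have "vs ! j \<notin> set (map ((!) vs) js')"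
    using b Cons.prems(1) realizes_distinct[OF vs] by (auto simp: js(1) nth_eq_iff_index_eq)
  moreover have "vs ! j \<in> S" using b(1) realizes_subset[OF vs] by auto
  moreover have "realizes E S q (map ((!) vs) js')"
    using Cons.IH[OF _ _ js(3)] Cons.prems by (auto simp: js(1))
  ultimately show ?case by (simp add: js(1))
qed

end

text \<open>The forbidden subgraphs enter only through the soundness of \<open>A\<close> and
  \<open>N\<close>, so one checker serves both four-colour theorems.\<close>

locale refutation = graph_rel E for E :: "'a \<Rightarrow> 'a \<Rightarrow> bool" +
  fixes S :: "'a set" and A N :: row_test
  assumes crit: "critical E S 4"
    and A_sound: "\<lbrakk>realizes E S p vs; u \<in> S; w \<in> S; E u w\<rbrakk> \<Longrightarrow> \<not> A p (map (E u) vs) (map (E w) vs)"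
    and N_sound: "\<lbrakk>realizes E S p vs; u \<in> S; w \<in> S; \<not> E u w\<rbrakk> \<Longrightarrow> \<not> N p (map (E u) vs) (map (E w) vs)"
begin

lemma row_in_types: "realizes E S p vs \<Longrightarrow> w \<in> S \<Longrightarrow> map (E w) vs \<in> set (row_types A N p)"
proof (induction p arbitrary: vs)
  case (Cons r p)
  then obtain v us where vs: "vs = v # us" "map (E v) us = r" "realizes E S p us" "v \<in> S"
    by (cases vs) auto
  have "map (E w) us \<in> set (row_types A N p)" using Cons.IH vs Cons.prems by blast
  moreover have "E w v \<Longrightarrow> \<not> A p (map (E w) us) r" "\<not> E w v \<Longrightarrow> \<not> N p (map (E w) us) r"
    using A_sound[OF vs(3)] N_sound[OF vs(3)] vs Cons.prems by blast+
  ultimately show ?case by (cases "E w v") (auto simp: vs(1) intro!: bexI[of _ "map (E w) us"])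
qed auto

definition "avoids known \<longleftrightarrow> (\<forall>q\<in>set known. \<not> occurs E S q)"

lemma witnessed_not_occurs:
  assumes "avoids known" "witnessed known p w"
  shows "\<not> realizes E S p vs"
proof
  assume vs: "realizes E S p vs"
  obtain k js where w: "w = (k, js)" by (cases w)
  have k: "k < length known" "distinct js" "list_all (\<lambda>j. j < length p) js"
      "induces (full_rows p) (known ! k) js"
    using assms(2) by (auto simp: witnessed_def w)
  from realizes_induces[OF vs k(2-4)] have "occurs E S (known ! k)" by (auto simp: occurs_def)
  then show False using assms(1) k(1) by (auto simp: avoids_def)
qed

lemma compare_sound:
  assumes known: "avoids known" and ok: "compare_ok A N known p i j ws"
  shows "\<not> occurs E S p"
proof
  assume "occurs E S p"
  then obtain vs where vs: "realizes E S p vs" by (auto simp: occurs_def)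
  have R: "full_rows p = map (\<lambda>v. map (E v) vs) vs" using full_rows_realizes[OF vs] .
  have len: "length vs = length p" using realizes_length[OF vs] .
  have ij: "i < length vs" "j < length vs" "i \<noteq> j" "\<not> E (vs ! i) (vs ! j)"
    and sub: "\<And>x. x \<in> set vs \<Longrightarrow> E (vs ! i) x \<Longrightarrow> E (vs ! j) x"
    and ws: "list_all2 (\<lambda>r w. witnessed known (r # p) w)
        (filter (\<lambda>r. r ! i \<and> \<not> r ! j) (row_types A N p)) ws"
    using ok by (auto simp: compare_ok_def Let_def R len list_all2_conv_all_nth in_set_conv_nth)
  have "vs ! i \<noteq> vs ! j" using ij realizes_distinct[OF vs] by (simp add: nth_eq_iff_index_eq)
  then obtain x where x: "x \<in> S" "E (vs ! i) x" "\<not> E (vs ! j) x"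
    using critical_not_comparable[OF crit sym irrefl, of "vs ! i" "vs ! j"] ij realizes_subset[OF vs]
    by (auto dest: nth_mem)
  let ?r = "map (E x) vs"
  have "?r \<in> set (filter (\<lambda>r. r ! i \<and> \<not> r ! j) (row_types A N p))"
    using row_in_types[OF vs x(1)] x ij adj_commute[of x "vs ! i"] adj_commute[of x "vs ! j"] by auto
  then obtain w where "witnessed known (?r # p) w"
    using list_all2_in_set_left[OF ws] by blast
  moreover have "realizes E S (?r # p) (x # vs)" using vs x sub by auto
  ultimately show False using witnessed_not_occurs[OF known] by blast
qed

lemma labels_ok_cases:
  assumes "labels_ok known p rs ls" "r \<in> set rs"
  shows "(\<exists>c. (r, c) \<in> set (colored_rows rs ls)) \<or>
    (r \<notin> set (full_rows p) \<and> (\<exists>w. witnessed known (r # p) w))"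
  using assms by (induction known p rs ls rule: labels_ok.induct) auto

lemma conflicts_complete:
  "(r, c) \<in> set rcs \<Longrightarrow> (s, c) \<in> set rcs \<Longrightarrow> \<not> B r s \<Longrightarrow> \<not> B s r \<Longrightarrow>
   (r, s) \<in> set (conflicts B rcs) \<or> (s, r) \<in> set (conflicts B rcs)"
proof (induction rcs)
  case (Cons x rcs)
  obtain t d where x: "x = (t, d)" by (cases x)
  show ?case
  proof (cases "(r, c) \<in> set rcs \<and> (s, c) \<in> set rcs")
    case True
    then show ?thesis using Cons by (auto simp: x)
  next
    case False
    then have "d = c" "t = r \<or> t = s" using Cons.prems(1,2) by (auto simp: x)
    have "(t, s') \<in> set (conflicts B (x # rcs))" if "(s', c) \<in> set (x # rcs)" "\<not> B t s'" for s'
      using that rev_image_eqI[of "(s', c)" _ "(t, s')" "\<lambda>(s, d). (t, s)"]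
      unfolding x conflicts.simps \<open>d = c\<close> by (cases "s' = t") auto
    then show ?thesis using Cons.prems \<open>t = r \<or> t = s\<close> by blast
  qed
qed simp

lemma static_sound:
  assumes known: "avoids known" and ok: "static_ok A N known p ls ws"
  shows "\<not> occurs E S p"
proof
  assume "occurs E S p"
  then obtain vs where vs: "realizes E S p vs" by (auto simp: occurs_def)
  have R: "full_rows p = map (\<lambda>v. map (E v) vs) vs" using full_rows_realizes[OF vs] .
  define T where "T = row_types A N p"
  define C where "C = colored_rows T ls"
  let ?row = "\<lambda>v. map (E v) vs"
  have lab: "labels_ok known p T ls"
    and ws: "list_all2 (\<lambda>(r, s) w. \<not> some_row (\<lambda>t. t = r) s (full_rows p) \<and>
          \<not> some_row (\<lambda>t. t = s) r (full_rows p) \<and> witnessed known ((True # s) # r # p) w)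
        (conflicts (A p) C) ws"
    using ok by (auto simp: static_ok_def Let_def T_def C_def)
  have ex: "\<exists>c. (?row v, c) \<in> set C" if v: "v \<in> S" for v
  proof (rule ccontr)
    assume "\<not> ?thesis"
    then obtain w where "?row v \<notin> set (full_rows p)" "witnessed known (?row v # p) w"
      using labels_ok_cases[OF lab] row_in_types[OF vs v] unfolding C_def T_def by blast
    then show False using witnessed_not_occurs[OF known, of "?row v # p" w "v # vs"] vs v
      by (auto simp: R)
  qed
  have no: False if c: "(r, s) \<in> set (conflicts (A p) C)" and rs: "r = ?row u" "s = ?row w"
      and uw: "u \<in> S" "w \<in> S" "E u w" for r s u w
  proof -
    obtain x where *: "\<not> some_row (\<lambda>t. t = r) s (full_rows p)"
        "\<not> some_row (\<lambda>t. t = s) r (full_rows p)" and x: "witnessed known ((True # s) # r # p) x"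
      using list_all2_in_set_left[OF ws c] by auto
    have "u \<notin> set vs" "w \<notin> set vs"
      using * uw sym[OF uw(3)] by (auto simp: rs R some_row_map)
    then have "realizes E S ((True # s) # r # p) (w # u # vs)"
      using vs uw irrefl sym[OF uw(3)] by (auto simp: rs)
    then show False using witnessed_not_occurs[OF known x] by blast
  qed
  define col where "col v = (SOME c. (?row v, c) \<in> set C)" for v
  have col: "(?row v, col v) \<in> set C" if "v \<in> S" for v
    using someI_ex[OF ex[OF that]] unfolding col_def .
  have proper: "col u \<noteq> col w" if uw: "u \<in> S" "w \<in> S" "E u w" for u w
  proof
    assume eq: "col u = col w"
    have "\<not> A p (?row u) (?row w)" "\<not> A p (?row w) (?row u)"
      using A_sound[OF vs] uw sym by blast+
    then have "(?row u, ?row w) \<in> set (conflicts (A p) C) \<or> (?row w, ?row u) \<in> set (conflicts (A p) C)"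
      using conflicts_complete[of "?row u" "col u" C "?row w"] col[OF uw(1)] col[OF uw(2)] eq by simp
    then show False using no uw sym by blast
  qed
  define num :: "bool \<times> bool \<Rightarrow> nat" where "num = (\<lambda>(a, b). (if a then 2 else 0) + (if b then 1 else 0))"
  have num: "num c < 4" "num c = num d \<longleftrightarrow> c = d" for c d
    by (auto simp: num_def split: prod.splits if_splits)
  have "colorable E S 4"
    unfolding colorable_def using proper by (intro exI[of _ "\<lambda>v. num (col v)"]) (simp add: num)
  then show False using crit unfolding critical_def by blast
qed

theorem refutes_sound:
  "refutes A N known steps \<Longrightarrow> avoids known \<Longrightarrow> (p, J) \<in> set steps \<Longrightarrow> \<not> occurs E S p"
proof (induction steps arbitrary: known)
  case (Cons step steps)
  obtain q K where step: "step = (q, K)" by (cases step)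
  have just: "justified A N known q K" and rest: "refutes A N (known @ [q]) steps"
    using Cons.prems(1) by (auto simp: step split: if_splits)
  have q: "\<not> occurs E S q"
    using just static_sound[OF Cons.prems(2)] compare_sound[OF Cons.prems(2)]
    by (cases K) simp_all
  then have "avoids (known @ [q])" using Cons.prems(2) by (auto simp: avoids_def)
  then show ?case using Cons.IH[OF rest] Cons.prems(3) q by (auto simp: step)
qed simp

end

section \<open>Induced matchings, cliques and the tests for the two graph classes\<close>

context graph_rel begin

text \<open>The matching is induced, as further edges are sought among the vertices adjacent to
  neither end. In this form the removal of an edge together with its neighbours, on which the
  inductions rest, is a single unfolding.\<close>

primrec has_matching :: "nat \<Rightarrow> 'a set \<Rightarrow> bool" where
  "has_matching 0 S \<longleftrightarrow> True"
| "has_matching (Suc k) S \<longleftrightarrow>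
     (\<exists>a\<in>S. \<exists>b\<in>S. E a b \<and> has_matching k {x \<in> S. \<not> E a x \<and> \<not> E b x})"

primrec has_clique :: "nat \<Rightarrow> 'a set \<Rightarrow> bool" where
  "has_clique 0 S \<longleftrightarrow> True"
| "has_clique (Suc k) S \<longleftrightarrow> (\<exists>a\<in>S. has_clique k {x \<in> S. E a x})"

lemma has_clique_3I:
  "\<lbrakk>a \<in> S; b \<in> S; c \<in> S; E a b; E a c; E b c\<rbrakk> \<Longrightarrow> has_clique 3 S"
  unfolding numeral_3_eq_3 has_clique.simps by blast

lemma has_clique_4I:
  "\<lbrakk>a \<in> S; b \<in> S; c \<in> S; d \<in> S; E a b; E a c; E a d; E b c; E b d; E c d\<rbrakk> \<Longrightarrow> has_clique 4 S"
  using has_clique.simps(2)[of 3 S] has_clique_3I[of b "{x \<in> S. E a x}" c d] by auto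

lemma has_matching_2I:
  "\<lbrakk>a \<in> S; b \<in> S; c \<in> S; d \<in> S; E a b; E c d;
    \<not> E a c; \<not> E a d; \<not> E b c; \<not> E b d\<rbrakk> \<Longrightarrow> has_matching 2 S"
  unfolding numeral_2_eq_2 has_matching.simps by blast

lemma has_matching_3I:
  "\<lbrakk>a \<in> S; b \<in> S; c \<in> S; d \<in> S; e \<in> S; f \<in> S; E a b; E c d; E e f;
    \<not> E a c; \<not> E a d; \<not> E b c; \<not> E b d; \<not> E a e; \<not> E a f; \<not> E b e; \<not> E b f;
    \<not> E c e; \<not> E c f; \<not> E d e; \<not> E d f\<rbrakk> \<Longrightarrow> has_matching 3 S"
  using has_matching.simps(2)[of 2 S] has_matching_2I[of c "{x \<in> S. \<not> E a x \<and> \<not> E b x}" d e f] by auto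

end

text \<open>Vertices are numbered from 0 in the order of insertion and list their smaller
  neighbours, whereas positions in certificates count from the latest vertex.\<close>

definition to_pattern :: "nat list list \<Rightarrow> pattern" where
  "to_pattern ns =
     rev (map (\<lambda>(k, l). map (\<lambda>j. j \<in> set l) (rev [0..<k])) (zip [0..<length ns] ns))"

definition two_edges_in :: "pattern \<Rightarrow> bool list list \<Rightarrow> bool list \<Rightarrow> bool" where
  "two_edges_in p R m =
     some_row (\<lambda>r. some_row (\<lambda>s. edge_in p (only_left (only_left m r) s)) (both m r) R) m R"

text \<open>A K4 or 2K2 through two adjacent vertices has them as an edge; the other two vertices
  form an edge among the common neighbours or among the common non-neighbours.\<close>

definition K4_2K2_adj :: row_test where
  "K4_2K2_adj p r s = (if edge_in p (both r s) then True else edge_in p (neither r s))"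

text \<open>Two non-adjacent vertices can only lie on different edges of a 2K2, the other ends being
  private neighbours that are not adjacent.\<close>

definition K4_2K2_non :: row_test where
  "K4_2K2_non p r s =
     some_row (\<lambda>t. some_both (only_left s r) (map Not t)) (only_left r s) (full_rows p)"

definition K3_3K2_adj :: row_test where
  "K3_3K2_adj p r s = (if some_both r s then True else two_edges_in p (full_rows p) (neither r s))"

text \<open>Again the two vertices lie on different edges; the third edge is sought outside the
  neighbourhoods of all four ends.\<close>

definition K3_3K2_non :: row_test where
  "K3_3K2_non p r s =
     (let R = full_rows p; m = neither r s in
      some_row (\<lambda>t. some_row (\<lambda>u. edge_in p (only_left (only_left m t) u))
        (only_left (only_left s r) t) R) (only_left r s) R)"

lemma (in graph_rel) refutation_K4_2K2:
  assumes "critical E S 4" "\<not> has_clique 4 S" "\<not> has_matching 2 S"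
  shows "refutation E S K4_2K2_adj K4_2K2_non"
proof unfold_locales
  note K4 = assms(2)[THEN notE, OF has_clique_4I] and M2 = assms(3)[THEN notE, OF has_matching_2I]
  fix p vs u w
  assume vs: "realizes E S p vs" and u: "u \<in> S" "w \<in> S"
  have sub: "set vs \<subseteq> S" using realizes_subset[OF vs] .
  note R = full_rows_realizes[OF vs]
  show "\<not> K4_2K2_adj p (map (E u) vs) (map (E w) vs)" if "E u w"
  proof
    assume "K4_2K2_adj p (map (E u) vs) (map (E w) vs)"
    then consider x y where "x \<in> set vs" "y \<in> set vs" "E x y" "E u x" "E w x" "E u y" "E w y"
      | x y where "x \<in> set vs" "y \<in> set vs" "E x y" "\<not> E u x" "\<not> E w x" "\<not> E u y" "\<not> E w y"
      using edge_in_realizes[OF vs, of "\<lambda>v. E u v \<and> E w v"]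
        edge_in_realizes[OF vs, of "\<lambda>v. \<not> E u v \<and> \<not> E w v"]
      by (auto simp: K4_2K2_adj_def mask_simps split: if_splits)
    then show False by cases (use K4[of u w] M2[of u w] u sub that in blast)+
  qed
  show "\<not> K4_2K2_non p (map (E u) vs) (map (E w) vs)" if "\<not> E u w"
  proof
    assume "K4_2K2_non p (map (E u) vs) (map (E w) vs)"
    then obtain x y where "x \<in> set vs" "y \<in> set vs" "E u x" "\<not> E w x" "E w y" "\<not> E u y" "\<not> E x y"
      by (auto simp: K4_2K2_non_def R mask_simps comp_def)
    then show False using M2[of u x w y] u sub that adj_commute[of x w] by auto
  qed
qed (use assms(1) in auto)

lemma (in graph_rel) refutation_K3_3K2:
  assumes "critical E S 4" "\<not> has_clique 3 S" "\<not> has_matching 3 S"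
  shows "refutation E S K3_3K2_adj K3_3K2_non"
proof unfold_locales
  note K3 = assms(2)[THEN notE, OF has_clique_3I] and M3 = assms(3)[THEN notE, OF has_matching_3I]
  fix p vs u w
  assume vs: "realizes E S p vs" and u: "u \<in> S" "w \<in> S"
  have sub: "set vs \<subseteq> S" using realizes_subset[OF vs] .
  note R = full_rows_realizes[OF vs]
  show "\<not> K3_3K2_adj p (map (E u) vs) (map (E w) vs)" if "E u w"
  proof
    assume "K3_3K2_adj p (map (E u) vs) (map (E w) vs)"
    then consider x where "x \<in> set vs" "E u x" "E w x"
      | a b where "a \<in> set vs" "b \<in> set vs" "\<not> E u a" "\<not> E w a" "E a b" "\<not> E u b" "\<not> E w b"
        "edge_in p (map (\<lambda>v. ((\<not> E u v \<and> \<not> E w v) \<and> \<not> E a v) \<and> \<not> E b v) vs)"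
      by (auto simp: K3_3K2_adj_def two_edges_in_def R mask_simps split: if_splits)
    then show False
    proof cases
      case 1
      then show False using K3[of u w x] u sub that by blast
    next
      case 2
      from edge_in_realizes[OF vs 2(8)] obtain c d where "c \<in> set vs" "d \<in> set vs" "E c d"
        "\<not> E u c" "\<not> E w c" "\<not> E a c" "\<not> E b c" "\<not> E u d" "\<not> E w d" "\<not> E a d" "\<not> E b d"
        by auto
      then show False using M3[of u w a b c d] 2(1-7) u sub that by auto
    qed
  qed
  show "\<not> K3_3K2_non p (map (E u) vs) (map (E w) vs)" if "\<not> E u w"
  proof
    assume "K3_3K2_non p (map (E u) vs) (map (E w) vs)"
    then obtain a b where ab: "a \<in> set vs" "b \<in> set vs" "E u a" "\<not> E w a" "E w b" "\<not> E u b" "\<not> E a b"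
      "edge_in p (map (\<lambda>v. ((\<not> E u v \<and> \<not> E w v) \<and> \<not> E a v) \<and> \<not> E b v) vs)"
      by (auto simp: K3_3K2_non_def R mask_simps Let_def)
    from edge_in_realizes[OF vs ab(8)] obtain c d where "c \<in> set vs" "d \<in> set vs" "E c d"
      "\<not> E u c" "\<not> E w c" "\<not> E a c" "\<not> E b c" "\<not> E u d" "\<not> E w d" "\<not> E a d" "\<not> E b d"
      by auto
    then show False using M3[of u a w b c d] ab(1-7) u sub that adj_commute[of a w] by auto
  qed
qed (use assms(1) in auto)

section \<open>The two sequences of excluded patterns\<close>

abbreviation (input) "c0 \<equiv> Colour False False"
abbreviation (input) "c1 \<equiv> Colour False True"
abbreviation (input) "c2 \<equiv> Colour True False"
abbreviation (input) "c3 \<equiv> Colour True True"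

text \<open>The first twenty patterns contain a 5-cycle with a vertex adjacent to exactly four of
  its vertices, and the next is that graph itself. Once it is excluded, the 5-wheel, C5 + K1 and
  finally K3 + K1 follow within seven steps.\<close>

definition K4_2K2_steps :: "(pattern \<times> justification) list" where
  "K4_2K2_steps =
   [
    (to_pattern [[], [0], [1], [2], [0,3], [0,1,2,3], [0,1,2,3], [5]], Compare 1 2 []),
    (to_pattern [[], [0], [1], [2], [0,3], [0,1,2,3], []], Compare 0 2 [(0, [1,2,0,3,4,5,6,7])]),
    (to_pattern [[], [0], [1], [2], [0,3], [0,1,2,3], [0,2,4,5], [0,3]], Compare 6 1 [(1,
      [1,6,4,0,7,3,2])]),
    (to_pattern [[], [0], [1], [2], [0,3], [0,1,2,3], [0,1,2,3], [0,3,5]], Compare 1 2 [(1,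
      [4,6,1,0,2,7,3]), (1, [4,7,1,0,2,6,3])]),
    (to_pattern [[], [0], [1], [2], [0,3], [0,1,2,3], [0,1,2,3], [0,2,5]], Compare 0 6 [(3,
      [0,3,2,4,5,6,7,8])]),
    (to_pattern [[], [0], [1], [2], [0,3], [0,1,2,3], [0,1,2,3]], Compare 1 0 [(4,
      [0,1,2,3,4,5,6,7]), (3, [0,1,2,3,4,5,6,7]), (4, [0,1,2,3,7,6,5,4]), (1, [0,1,3,4,5,6,7])]),
    (to_pattern [[], [0], [1], [2], [0,3], [0,1,2,3], [0,2,5]], Compare 5 0 [(5,
      [0,2,3,4,5,6,7]), (2, [3,6,2,0,4,5,1,7])]),
    (to_pattern [[], [0], [1], [2], [0,3], [0,1,2,3], [0,3]], Compare 2 0 [(5, [0,2,1,4,5,6,7]),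
      (6, [0,2,1,4,5,6,7]), (6, [0,2,1,7,6,5,4])]),
    (to_pattern [[], [0], [1], [2], [0,3], [0,1,2,3], [0,2,4,5], [1,2,3,4,6], [5,6,7]], Compare 0
      6 []),
    (to_pattern [[], [0], [1], [2], [0,3], [0,1,2,3], [0,1,3], [1,4,5], [0,1,2,4]], Static [c0,
      c0, c0, c0, c0, c1, c1, c3, c3, c1, c1, c1, c1, c2, c2, c2, c2, c2, c3, c3, c3, c1] []),
    (to_pattern [[], [0], [1], [2], [0,3], [0,1,2,3], [0,1,3], [0,1,2,3,4], [0,3,5,6,7]], Static
      [c0, c0, c0, c0, c0, c0, c3, c1, c1, c0, c1, c1, c1, Excluded 5 [2,4,0,6,7,8,9], c3,
      Excluded 5 [3,4,5,6,0,8,9], c2, Excluded 5 [3,4,0,6,1,9,8], c2, Excluded 5 [2,3,0,6,1,9,8],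
      c2, c2, c2, c3, c3, c1, c1, c1, c1] [(5, [1,4,8,7,2,0,9])]),
    (to_pattern [[], [0], [1], [2], [0,3], [0,1,2,3], [0,2,4,5], [0,1,2,3,4], [0,1,2,3,4]],
      Static [c0, c0, c0, c0, c0, c3, c1, c1, c0, Excluded 6 [1,6,3,4,0,2,5], c1, Excluded 6
      [3,4,0,6,7,8,9], c0, c3, Excluded 7 [1,0,2,5,3,4,8], c2, c2, c2, c2, Excluded 6
      [1,5,0,3,9,2,6], c2, Excluded 6 [1,0,3,4,8,2,5], c3, c3, Excluded 6 [1,6,0,4,7,2,5], c3,
      c3, c3, Excluded 6 [1,9,0,4,8,2,5], c1, c1, Excluded 6 [6,7,0,3,4,8,1], c0] [(7,
      [2,0,3,6,4,1,9]), (6, [2,6,1,0,7,3,10])]),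
    (to_pattern [[], [0], [1], [2], [0,3], [0,1,2,3], [0,2,4,5], [1,2,3,4,6]], Static [c1, c1,
      c2, c1, c1, c0, c0, c0, c2, c2, c2, c1, c3, c3, c3, c2, c1, c3, c3, c3, c0, c3, Excluded 8
      [0,1,2,3,4,5,6,7,8], c0, c2, c1] [(8, [0,6,1,8,5,2,7,4,9]), (8, [0,2,1,4,5,6,7,8,9]), (11,
      [1,2,9,4,5,0,8,7,3]), (11, [3,6,1,8,5,2,7,4,0]), (10, [1,3,0,6,9,5,2,7,4])]),
    (to_pattern [[], [0], [1], [2], [0,3], [0,1,2,3], [1,2,4], [0,1,2,3,4]], Static [c0, c0,
      Excluded 12 [6,1,8,5,3,7,0,4], c0, c0, c3, c1, c1, c3, c1, c1, Excluded 5 [1,3,0,5,6,7,8],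
      Excluded 12 [5,1,7,4,0,6,3,8], c3, c2, c2, c2, c2, Excluded 12 [0,1,6,4,2,7,3,5], c2, c2,
      Excluded 12 [0,1,7,4,2,6,3,8], c3, c3, c1, c1, c1] [(12, [0,2,8,5,1,7,4,9])]),
    (to_pattern [[], [0], [1], [2], [0,3], [0,1,2,3], [0,2,4,5], [0,1,2,3,4]], Static [c0, c0,
      Excluded 12 [6,1,8,5,3,7,0,4], c0, c0, c2, c2, c3, c0, c3, c3, c0, Excluded 12
      [0,2,3,4,5,6,7,8], Excluded 13 [1,0,3,4,5,6,7,8], Excluded 12 [0,5,6,4,2,3,7,1], c1, c1,
      c0, c1, Excluded 12 [1,8,3,4,0,7,6,2], Excluded 13 [8,0,6,4,1,7,3,2], c2, c2, c1, c1, c1,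
      c0] [(13, [1,3,2,0,6,5,9,8])]),
    (to_pattern [[], [0], [1], [2], [0,3], [0,1,2,3], [0,2,4,5], [5,6]], Compare 0 7 [(12,
      [0,2,3,4,5,6,7,8]), (13, [2,5,7,4,0,6,3,8]), (9, [7,1,5,2,0,4,8,3,6])]),
    (to_pattern [[], [0], [1], [2], [0,3], [0,1,2,3], [0,3,5], [0,1,2,3,4,6]], Compare 3 1 [(14,
      [1,0,3,4,5,6,7,8]), (14, [1,0,3,4,8,7,6,5])]),
    (to_pattern [[], [0], [1], [2], [0,3], [0,1,2,3], [1,2,4]], Static [c1, c1, c1, c0, c0, c3,
      c3, c3, c1, c0, c0, c1, c1, c2, c2, c2, c1, c2, c2, c3, c3, c2, c0] [(15,
      [0,1,6,4,2,7,3,5]), (15, [0,1,7,4,2,6,3,8]), (15, [0,1,7,4,2,6,3,8]), (14,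
      [6,8,1,3,5,0,2,7]), (14, [3,2,1,6,5,0,8,7]), (14, [3,2,1,7,8,0,5,6]), (15,
      [1,0,6,4,2,7,3,5]), (15, [0,1,3,4,8,7,6,5]), (15, [0,1,3,4,8,7,6,5])]),
    (to_pattern [[], [0], [1], [2], [0,3], [0,1,2,3], [0,2,4,5]], Static [Excluded 14
      [0,1,2,3,4,5,6,7], c2, c2, c2, c3, c3, c0, c0, c3, c3, c3, c3, Excluded 6 [1,2,0,4,5,6,7],
      c2, Excluded 17 [0,2,3,4,5,6,7], Excluded 17 [0,2,3,4,5,6,7], c1, c1, c2, c1, c1, c0,
      Excluded 15 [0,1,2,3,4,5,6,7], c0, c2, c3] [(6, [0,1,4,8,7,6,5]), (15, [0,2,1,4,5,6,7,8]),
      (17, [0,8,5,3,7,1,4]), (16, [2,1,7,4,0,6,3,8]), (16, [3,2,1,7,6,5,0,8]), (15,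
      [0,1,3,4,5,6,7,8]), (17, [0,2,5,4,8,1,6])]),
    (to_pattern [[], [0], [1], [2], [0,3], [0,1,2,3], [0,1,2,3,4]], Compare 1 0 [(18,
      [0,2,3,4,5,6,7]), (18, [0,2,3,7,6,5,4]), (18, [7,6,3,0,2,5,1]), (18, [4,5,3,0,2,6,1])]),
    (to_pattern [[], [0], [1], [2], [0,3], [0,1,2,3]], Static [Excluded 19 [0,1,2,3,4,5,6], c2,
      c2, c2, c1, Excluded 18 [0,1,2,3,4,5,6], c1, c1, c3, c1, c2, c0, Excluded 18
      [0,1,2,6,5,4,3], c3, c2, c0, c0, c3, c0] [(6, [0,1,3,7,6,5,4]), (18, [5,6,4,0,1,7,2]), (18,
      [1,0,7,3,4,5,6]), (5, [1,2,3,4,5,0,7]), (18, [1,2,0,4,5,6,7]), (18, [0,6,3,7,2,5,1]), (18,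
      [0,5,3,4,2,6,1]), (18, [0,2,3,4,5,6,1])]),
    (to_pattern [[], [0], [1], [2], [0,3], [0,1,2,3,4]], Static [c0, Excluded 20 [0,2,3,4,5,6],
      Excluded 20 [0,3,2,6,5,4], Excluded 20 [0,4,3,2,6,5], c2, Excluded 20 [0,5,4,3,2,6], c1,
      c0, c1, Excluded 20 [1,0,4,3,2,6], c1, Excluded 20 [1,0,3,4,5,6], Excluded 20
      [0,6,2,3,4,5], c0, c2, c2, Excluded 20 [1,0,3,2,6,5], c3, Excluded 20 [1,0,2,3,4,5], c3,
      Excluded 20 [1,0,2,6,5,4], c3, c1] [(20, [1,3,4,0,6,7]), (20, [1,3,4,5,0,7]), (20,
      [1,6,5,4,0,7]), (20, [1,7,3,4,0,6])]),
    (to_pattern [[], [0], [1], [2], [0,3], [0,1,3], [0,1,3], [5]], Compare 1 2 [(20,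
      [8,1,0,2,7,3]), (20, [7,1,0,2,8,3])]),
    (to_pattern [[], [0], [1], [2], [0,3], [0,1,3], []], Compare 0 1 [(21, [0,3,4,5,6,7]), (20,
      [0,3,4,5,6,7]), (20, [0,5,4,3,7,6]), (22, [1,2,0,3,4,5,6,7])]),
    (to_pattern [[], [0], [1], [2], [0,3], [0,1,3], [5]], Static [c3, Excluded 20 [0,3,4,5,6,7],
      Excluded 20 [0,4,3,7,6,5], Excluded 20 [0,5,4,3,7,6], c0, Excluded 23 [1,0,3,4,5,6,7],
      Excluded 20 [0,6,5,4,3,7], Excluded 20 [0,6,5,4,3,7], c2, Excluded 23 [1,0,3,7,6,5,4], c2,
      c2, Excluded 23 [1,0,4,5,6,7,3], c2, Excluded 20 [2,5,4,0,7,6], c0, Excluded 20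
      [0,7,3,4,5,6], Excluded 20 [0,7,3,4,5,6], c3, Excluded 23 [1,0,4,3,7,6,5], c3, Excluded 23
      [1,0,5,6,7,3,4], c3, Excluded 20 [2,3,4,0,6,7], c0, c1, c1, c1, Excluded 23
      [0,2,3,4,5,6,7]] [(20, [1,6,5,0,8,7]), (20, [1,4,5,0,7,8]), (20, [0,7,3,2,1,6]), (20,
      [1,4,5,6,0,8]), (20, [1,8,3,2,0,4]), (23, [2,0,5,6,7,1,4])]),
    (to_pattern [[], [0], [1], [2], [0,3], []], Compare 0 5 [(20, [0,6,2,3,4,5]), (24,
      [1,0,3,2,6,5,4]), (24, [1,0,4,5,6,2,3])]),
    (to_pattern [[], [0], [0,1], [], [0,1,3]], Compare 2 0 [(20, [5,2,0,3,4,1]), (20,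
      [4,2,0,3,5,1])]),
    (to_pattern [[], [0], [0,1], []], Compare 0 3 [(26, [0,1,4,2,3])])]"

text \<open>All patterns extend C5 + K2 + K1, which comes last: its isolated vertex is compared with
  a vertex of the cycle. The extensions to be refuted there are the three excluded just before,
  where a new vertex sees the isolated vertex, one end of the edge and none, one or two vertices of
  the cycle.\<close>

definition K3_3K2_steps :: "(pattern \<times> justification) list" where
  "K3_3K2_steps =
   [
    (to_pattern [[], [0], [1], [2], [0,3], [], [5], [], [0,2,5,7], [1,3,6,7]], Static [c1, c1,
      c1, c3, c3, c3, c1, c1, c2, c2, c3, c1, c1, c1, c3, c1, c2, c2, c2, c2, c2, c2, c0, c2, c0,
      c1, c2, c1, c1, c1, c0, c1, c3, c1, c2, c2, c2, c1, c0, c1, c1, c3, c2, c0, c0, c3, c3] []),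
    (to_pattern [[], [0], [1], [2], [0,3], [], [5], [], [0,2,5], [1,3,6,7]], Static [c1, c1, c1,
      c3, c0, c0, c1, c1, c3, c3, c3, c1, c1, c1, c3, c1, c2, c2, c2, c2, c2, c3, c2, c2, c2, c2,
      c1, c2, c2, c1, c1, c1, c0, c1, c1, c2, c3, c2, c3, c1, c2, c2, c1, c1, c2, c2, c3, c0, c0,
      c0, c0] []),
    (to_pattern [[], [0], [1], [2], [0,3], [], [5], [], [0,5], [1,3,6,7]], Static [c0, c0, c0,
      c1, c0, c0, c3, c3, c0, c0, c0, c3, c0, c2, c2, c2, c2, c2, c3, c0, c2, c2, c2, c2, c2, c0,
      c2, c2, c1, c1, c1, c0, c2, c0, c2, c2, c3, c0, c0, c2, c2, c0, c2, c2, c1, c1, c1, c1] []),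
    (to_pattern [[], [0], [1], [2], [0,3], [], [5], [], [5,7], [0,2,6,7]], Static [c0, c0, c1,
      c0, c2, c2, c0, c1, c1, c2, c0, c1, c2, c2, c2, c1, c1, c1, c2, c3, c3, c3, c1, c1, c1, c3,
      c3, c3, c0, c1, c1, c3, c0, c1, c2, c1, c3, c1, c0, c2, c0, c1, c1, c0] []),
    (to_pattern [[], [0], [1], [2], [0,3], [], [5], [], [0,2,5], [0,3,6,7]], Static [c0, c0, c1,
      c1, c3, c3, c3, c1, c3, c1, c3, c3, c2, Excluded 1 [0,2,3,4,5,6,7,8,9,10], c2, c2, c0, c2,
      c2, c2, c2, Excluded 2 [1,2,3,4,5,9,0,6,7,8], c3, c0, Excluded 2 [1,0,3,4,5,8,7,6,10,9],
      c2, c2, Excluded 0 [0,1,3,5,4,9,8,7,6,10], c0, Excluded 1 [1,0,3,4,5,9,10,6,7,8], c3, c0,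
      c0, c0, Excluded 2 [1,0,3,4,5,9,10,6,7,8], c1, c3, c2, c3, c2, c3, c0, c2, c3, c3, c0, c2,
      c2, c1, c2, c2, c1, c1] [(1, [8,6,7,9,3,4,2,5,1,0]), (1, [8,6,7,9,3,4,2,5,1,0]), (1,
      [8,6,7,9,3,4,2,5,0,1]), (0, [0,11,7,4,2,6,1,10,9,3]), (0, [1,11,10,6,3,4,0,7,8,2]), (1,
      [8,6,7,9,3,4,2,5,0,1]), (1, [8,6,7,9,3,4,2,5,1,0])]),
    (to_pattern [[], [0], [1], [2], [0,3], [], [5], [], [0,2,5,7], [0,6,7]], Static [c1, c3, c1,
      c1, c3, c3, c2, c1, c3, Excluded 0 [0,10,9,7,6,4,5,2,3,1], c2, c2, Excluded 0
      [0,2,3,4,5,6,7,8,9,10], c2, c2, c2, c2, c2, c2, c0, Excluded 0 [0,2,3,4,5,7,6,10,9,8], c0,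
      c0, c0, c0, c0, c0, c0, c0, c0, c0, c0, c0, c1, c1, c3, c1, c2, c3, c2, c3, c0, c0, c1, c3,
      c3, c2, c1] [(0, [0,11,1,8,7,5,6,3,4,2]), (0, [1,11,10,8,7,5,6,3,0,2]), (0,
      [1,3,0,5,6,7,8,9,10,11])]),
    (to_pattern [[], [0], [1], [2], [0,3], [], [5], [], [5,7], [6,7]], Static [Excluded 3
      [0,1,3,5,4,6,7,8,9,10], Excluded 3 [0,2,5,1,3,6,7,8,9,10], Excluded 3
      [0,2,3,4,5,6,7,8,9,10], Excluded 3 [0,1,4,2,3,6,7,8,9,10], Excluded 3
      [0,4,1,2,5,6,7,8,9,10], c0, Excluded 3 [0,1,3,5,4,8,9,10,6,7], Excluded 3
      [0,2,5,1,3,8,9,10,6,7], Excluded 3 [0,2,3,4,5,8,9,10,6,7], Excluded 3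
      [0,1,4,2,3,8,9,10,6,7], Excluded 3 [0,4,1,2,5,8,9,10,6,7], c0, Excluded 3
      [0,1,3,5,4,6,10,9,8,7], Excluded 3 [0,2,5,1,3,6,10,9,8,7], Excluded 3
      [0,2,3,4,5,6,10,9,8,7], Excluded 3 [0,1,4,2,3,6,10,9,8,7], Excluded 3
      [0,4,1,2,5,6,10,9,8,7], c1, Excluded 3 [0,1,3,5,4,7,8,9,10,6], Excluded 3
      [0,2,5,1,3,7,8,9,10,6], Excluded 3 [0,2,3,4,5,7,8,9,10,6], Excluded 3
      [0,1,4,2,3,7,8,9,10,6], Excluded 3 [0,4,1,2,5,7,8,9,10,6], c1, Excluded 3
      [0,1,3,5,4,9,10,6,7,8], Excluded 3 [0,2,5,1,3,9,10,6,7,8], Excluded 3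
      [0,2,3,4,5,9,10,6,7,8], Excluded 3 [0,1,4,2,3,9,10,6,7,8], Excluded 3
      [0,4,1,2,5,9,10,6,7,8], c2, c0, c0, c1, c1, c2, c0] []),
    (to_pattern [[], [0], [1], [2], [0,3], [], [5], [], [5,7]], Compare 2 0 [(3,
      [0,1,2,3,4,5,6,7,8,9]), (3, [0,1,2,3,4,7,8,9,5,6]), (3, [0,1,2,3,4,5,9,8,7,6]), (3,
      [0,1,2,3,4,6,7,8,9,5]), (3, [0,1,2,3,4,8,9,5,6,7]), (6, [0,1,2,3,4,5,6,7,8,9])]),
    (to_pattern [[], [0], [1], [2], [0,3], [], [5], [], [0,5,7]], Static [c1, c1, Excluded 5
      [1,0,2,4,3,5,6,7,8,9], c0, c1, c1, Excluded 5 [1,0,2,4,3,8,7,6,5,9], c3, c1, c1, Excluded 7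
      [6,5,8,7,0,2,1,4,3], c1, c1, c2, c2, c2, c3, c3, c1, c1, c2, c2, Excluded 7
      [1,2,3,4,0,5,6,7,8], c1, c2, c1, c1, c2, c2, c2, c0, c0, c1, c1, c2, c2, c1, c1, c2, c2,
      c1, c2, Excluded 7 [0,2,3,4,5,6,7,8,9], c1, c2, c0, c0] [(5, [2,0,3,5,4,6,7,8,9,1]), (5,
      [2,0,3,5,4,9,8,7,6,1])]),
    (to_pattern [[], [0], [1], [2], [0,3], [], [5], [], [0,2,5,7]], Static [c2, c1, c1, c1, c2,
      c2, c2, Excluded 4 [1,0,2,4,3,8,7,6,5,9], c2, Excluded 8 [0,2,3,4,5,6,7,8,9], c2, Excluded
      8 [0,2,4,3,5,6,7,8,9], c2, c2, Excluded 0 [0,1,2,3,4,5,6,7,8,9], c0, c0, c0, Excluded 8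
      [1,2,3,4,5,6,0,8,9], c3, c3, Excluded 0 [0,1,2,3,4,6,5,9,8,7], c0, c0, c0, Excluded 8
      [1,2,3,4,6,5,0,8,7], Excluded 8 [0,2,3,4,7,6,5,9,8], c0, c3, c3, c1, Excluded 4
      [1,0,2,4,3,8,9,5,6,7], c1, Excluded 8 [0,2,3,4,6,5,9,8,7], c1, Excluded 8
      [0,2,4,3,6,5,9,8,7], Excluded 8 [0,2,3,4,5,9,8,7,6], c2, Excluded 8 [0,2,4,3,5,9,8,7,6],
      c0, c0, Excluded 8 [0,2,3,4,6,7,8,9,5], c3, Excluded 8 [0,2,4,3,6,7,8,9,5], c0, c0, c1, c3,
      Excluded 8 [7,8,5,6,2,0,3,4,1], c0, c0, c1] [(8, [0,3,4,5,8,7,6,10,1]), (0,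
      [1,2,0,4,5,6,7,8,9,10]), (4, [2,0,3,5,4,9,10,6,7,1]), (0, [1,2,0,4,5,7,6,10,9,8]), (4,
      [2,0,3,5,4,9,8,7,6,1]), (4, [1,2,0,4,5,7,6,10,9,8]), (8, [0,3,4,5,6,10,9,8,1]), (8,
      [1,0,5,4,6,10,9,8,7]), (8, [1,0,5,4,7,8,9,10,6]), (8, [5,4,0,1,8,7,6,10,2])]),
    (to_pattern [[], [0], [1], [2], [0,3], [], [5], []], Compare 0 7 [(9, [0,1,2,3,4,8,7,6,5]),
      (9, [0,1,3,2,4,8,7,6,5]), (9, [0,1,2,3,5,6,7,8,4]), (9, [0,1,3,2,5,6,7,8,4]), (8,
      [0,1,2,3,6,5,4,8,7]), (8, [0,1,3,2,6,5,4,8,7]), (9, [0,1,2,3,7,8,4,5,6]), (9,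
      [0,1,3,2,7,8,4,5,6]), (8, [0,1,2,3,5,4,8,7,6]), (8, [0,1,3,2,5,4,8,7,6]), (8,
      [0,1,2,3,4,8,7,6,5]), (8, [0,1,3,2,4,8,7,6,5]), (8, [0,1,2,3,5,6,7,8,4]), (8,
      [0,1,3,2,5,6,7,8,4]), (7, [0,1,2,3,4,5,6,7,8]), (7, [0,1,3,2,4,5,6,7,8])])]"

lemma K4_2K2_steps_refute: "refutes K4_2K2_adj K4_2K2_non [] K4_2K2_steps"
  by code_simp

lemma K3_3K2_steps_refute: "refutes K3_3K2_adj K3_3K2_non [] K3_3K2_steps"
  by code_simp

section \<open>Graphs without two or three independent edges\<close>

lemma colorableI:
  assumes "\<And>v. v \<in> S \<Longrightarrow> c v < k" "\<And>u v. u \<in> S \<Longrightarrow> v \<in> S \<Longrightarrow> E u v \<Longrightarrow> c u \<noteq> (c v :: nat)"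
  shows "colorable E S k"
  unfolding colorable_def using assms by blast

lemma colorable_mono:
  assumes "colorable E S k" "T \<subseteq> S" "k \<le> l"
  shows "colorable E T l"
proof -
  obtain c where c: "\<forall>v\<in>S. c v < k" "\<forall>u\<in>S. \<forall>v\<in>S. E u v \<longrightarrow> c u \<noteq> (c v :: nat)"
    using assms(1) unfolding colorable_def by blast
  show ?thesis
  proof (rule colorableI)
    show "c v < l" if "v \<in> T" for v using c(1) assms(2,3) that by fastforce
    show "c u \<noteq> c v" if "u \<in> T" "v \<in> T" "E u v" for u v using c(2) assms(2) that by blast
  qed
qed

context graph_rel begin

lemma colorable_Un:
  assumes "colorable E S k" "colorable E T l"
  shows "colorable E (S \<union> T) (k + l)"
proof -
  obtain c where c: "\<forall>v\<in>S. c v < k" "\<forall>u\<in>S. \<forall>v\<in>S. E u v \<longrightarrow> c u \<noteq> (c v :: nat)"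
    using assms(1) unfolding colorable_def by blast
  obtain d where d: "\<forall>v\<in>T. d v < l" "\<forall>u\<in>T. \<forall>v\<in>T. E u v \<longrightarrow> d u \<noteq> (d v :: nat)"
    using assms(2) unfolding colorable_def by blast
  show ?thesis
  proof (rule colorableI[where c = "\<lambda>v. if v \<in> S then c v else k + d v"])
    show "(if v \<in> S then c v else k + d v) < k + l" if "v \<in> S \<union> T" for v
      using c(1) d(1) that by (auto intro: trans_less_add1)
    show "(if u \<in> S then c u else k + d u) \<noteq> (if v \<in> S then c v else k + d v)"
      if "u \<in> S \<union> T" "v \<in> S \<union> T" "E u v" for u v
      using c(1)[rule_format, of u] c(1)[rule_format, of v] c(2)[rule_format, of u v]
        d(2)[rule_format, of u v] that by auto
  qed
qed

lemma colorable_cover: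
  assumes "colorable E S k" "colorable E T l" "U \<subseteq> S \<union> T" "k + l \<le> m"
  shows "colorable E U m"
  using colorable_mono[OF colorable_Un[OF assms(1,2)] assms(3,4)] .

lemma colorable_1: "(\<And>u v. u \<in> S \<Longrightarrow> v \<in> S \<Longrightarrow> \<not> E u v) \<Longrightarrow> colorable E S 1"
  by (rule colorableI[where c = "\<lambda>_. 0"]) auto

lemma colorable_insert:
  assumes "finite S" "v \<notin> S" "colorable E S k" "card {x \<in> S. E v x} < k"
  shows "colorable E (insert v S) k"
proof -
  obtain c where c: "\<forall>x\<in>S. c x < k" "\<forall>x\<in>S. \<forall>y\<in>S. E x y \<longrightarrow> c x \<noteq> (c y :: nat)"
    using assms(3) unfolding colorable_def by blast
  have "card (c ` {x \<in> S. E v x}) < card {..<k}"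
    using card_image_le[of "{x \<in> S. E v x}" c] assms(1,4) by simp
  then have "\<not> {..<k} \<subseteq> c ` {x \<in> S. E v x}"
    using card_mono[of "c ` {x \<in> S. E v x}" "{..<k}"] assms(1) by auto
  then obtain i where i: "i < k" "i \<notin> c ` {x \<in> S. E v x}" by auto
  show ?thesis
  proof (rule colorableI[where c = "c(v := i)"])
    show "(c(v := i)) x < k" if "x \<in> insert v S" for x using that c(1) i(1) by auto
    show "(c(v := i)) x \<noteq> (c(v := i)) y" if "x \<in> insert v S" "y \<in> insert v S" "E x y" for x y
      using that c(2) i(2) irrefl[of v] sym[OF that(3)] by auto
  qed
qed

lemma colorable_insert_isolated:
  assumes "colorable E S k" "0 < k" "\<And>x. x \<in> S \<Longrightarrow> \<not> E v x"
  shows "colorable E (insert v S) k"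
proof -
  obtain c where c: "\<forall>x\<in>S. c x < k" "\<forall>x\<in>S. \<forall>y\<in>S. E x y \<longrightarrow> c x \<noteq> (c y :: nat)"
    using assms(1) unfolding colorable_def by blast
  show ?thesis
  proof (rule colorableI[where c = "c(v := 0)"])
    show "(c(v := 0)) x < k" if "x \<in> insert v S" for x using that c(1) assms(2) by auto
    show "(c(v := 0)) x \<noteq> (c(v := 0)) y" if "x \<in> insert v S" "y \<in> insert v S" "E x y" for x y
      using that c(2) irrefl[of v] sym[OF that(3)] assms(3)[of x] assms(3)[of y] by auto
  qed
qed

lemma has_matching_mono: "has_matching k S \<Longrightarrow> S \<subseteq> T \<Longrightarrow> has_matching k T"
proof (induction k arbitrary: S T)
  case (Suc k)
  then obtain a b where ab: "a \<in> S" "b \<in> S" "E a b" "has_matching k {x \<in> S. \<not> E a x \<and> \<not> E b x}"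
    by auto
  have "has_matching k {x \<in> T. \<not> E a x \<and> \<not> E b x}"
    by (rule Suc.IH[OF ab(4)]) (use Suc.prems in auto)
  then show ?case using ab Suc.prems by auto
qed simp

lemma not_has_matching_nonneighbours:
  assumes "\<not> has_matching (Suc k) S" "a \<in> S" "b \<in> S" "E a b"
    and "\<And>x. x \<in> T \<Longrightarrow> x \<in> S \<and> \<not> E a x \<and> \<not> E b x"
  shows "\<not> has_matching k T"
  using assms has_matching_mono[of k T "{x \<in> S. \<not> E a x \<and> \<not> E b x}"] by auto

lemma has_clique_iff:
  "has_clique k S \<longleftrightarrow>
     (\<exists>K\<subseteq>S. finite K \<and> card K = k \<and> (\<forall>x\<in>K. \<forall>y\<in>K. x \<noteq> y \<longrightarrow> E x y))"
proof (induction k arbitrary: S)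
  case 0
  show ?case by (auto intro!: exI[of _ "{}"])
next
  case (Suc k)
  show ?case
  proof
    assume "has_clique (Suc k) S"
    then obtain a where a: "a \<in> S" "has_clique k {x \<in> S. E a x}" by auto
    then obtain K where K: "K \<subseteq> {x \<in> S. E a x}" "finite K" "card K = k"
        "\<forall>x\<in>K. \<forall>y\<in>K. x \<noteq> y \<longrightarrow> E x y"
      using Suc.IH by auto
    have "a \<notin> K" using K(1) irrefl by auto
    then show "\<exists>K\<subseteq>S. finite K \<and> card K = Suc k \<and> (\<forall>x\<in>K. \<forall>y\<in>K. x \<noteq> y \<longrightarrow> E x y)"
      using K a by (intro exI[of _ "insert a K"]) (auto intro: sym[of a])
  next
    assume "\<exists>K\<subseteq>S. finite K \<and> card K = Suc k \<and> (\<forall>x\<in>K. \<forall>y\<in>K. x \<noteq> y \<longrightarrow> E x y)"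
    then obtain K where K: "K \<subseteq> S" "finite K" "card K = Suc k"
        "\<forall>x\<in>K. \<forall>y\<in>K. x \<noteq> y \<longrightarrow> E x y" by blast
    then have "K \<noteq> {}" by auto
    then obtain a where a: "a \<in> K" by blast
    have "has_clique k {x \<in> S. E a x}"
      unfolding Suc.IH using K a by (intro exI[of _ "K - {a}"]) auto
    then show "has_clique (Suc k) S" using a K(1) by auto
  qed
qed

lemma has_cliqueE:
  assumes "has_clique k S"
  obtains K where "K \<subseteq> S" "finite K" "card K = k" "\<forall>x\<in>K. \<forall>y\<in>K. x \<noteq> y \<longrightarrow> E x y"
  using assms unfolding has_clique_iff by metis

lemma has_cliqueI:
  assumes "K \<subseteq> S" "finite K" "card K = k" "\<forall>x\<in>K. \<forall>y\<in>K. x \<noteq> y \<longrightarrow> E x y"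
  shows "has_clique k S"
  unfolding has_clique_iff using assms by (intro exI[of _ K]) auto

lemma has_clique_mono: "has_clique k S \<Longrightarrow> S \<subseteq> T \<Longrightarrow> has_clique k T"
  by (elim has_cliqueE, rule has_cliqueI) auto

lemma has_clique_le:
  assumes "has_clique k S" "l \<le> k"
  shows "has_clique l S"
proof -
  obtain K where K: "K \<subseteq> S" "finite K" "card K = k" "\<forall>x\<in>K. \<forall>y\<in>K. x \<noteq> y \<longrightarrow> E x y"
    using assms(1) by (rule has_cliqueE)
  obtain L where "L \<subseteq> K" "card L = l" "finite L"
    using obtain_subset_with_card_n[of l K] assms(2) K(3) by auto
  then show ?thesis using K by (intro has_cliqueI[of L]) auto
qed

lemma not_has_clique_neighbours:
  assumes "\<not> has_clique (Suc k) S" "a \<in> S" "\<And>x. x \<in> T \<Longrightarrow> x \<in> S \<and> E a x"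
  shows "\<not> has_clique k T"
  using assms has_clique_mono[of k T "{x \<in> S. E a x}"] by auto

section \<open>The two four-colour theorems\<close>

definition five_cycle :: "'a \<Rightarrow> 'a \<Rightarrow> 'a \<Rightarrow> 'a \<Rightarrow> 'a \<Rightarrow> bool" where
  "five_cycle a b c d e \<longleftrightarrow> E a b \<and> E b c \<and> E c d \<and> E d e \<and> E a e \<and>
     \<not> E a c \<and> \<not> E a d \<and> \<not> E b d \<and> \<not> E b e \<and> \<not> E c e"

lemma five_cycle_realizes:
  assumes "five_cycle a b c d e" "a \<in> S" "b \<in> S" "c \<in> S" "d \<in> S" "e \<in> S"
  shows "realizes E S [[True, False, False, True], [True, False, False], [True, False], [True], []]
    [e, d, c, b, a]"
  using assms irrefl adj_commute[of b a] adj_commute[of c a] adj_commute[of d a] adj_commute[of e a]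
    adj_commute[of c b] adj_commute[of d b] adj_commute[of e b] adj_commute[of d c]
    adj_commute[of e c] adj_commute[of e d]
  by (auto simp: five_cycle_def)

text \<open>For an edge \<open>xy\<close> the neighbours of \<open>x\<close>, those of
  \<open>y\<close> and the vertices missing both are three independent sets. A vertex of the third
  set joins one of the other two in which it has no neighbour; if it has neighbours in both, these
  and \<open>x\<close>, \<open>y\<close> close an induced 5-cycle.\<close>

lemma two_colorable_or_five_cycle:
  assumes K3: "\<not> has_clique 3 S" and M2: "\<not> has_matching 2 S"
  shows "colorable E S 2 \<or> (\<exists>a\<in>S. \<exists>b\<in>S. \<exists>c\<in>S. \<exists>d\<in>S. \<exists>e\<in>S. five_cycle a b c d e)"
proof (rule disjCI)
  assume no: "\<not> (\<exists>a\<in>S. \<exists>b\<in>S. \<exists>c\<in>S. \<exists>d\<in>S. \<exists>e\<in>S. five_cycle a b c d e)"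
  note tri = K3[THEN notE, OF has_clique_3I] and mat = M2[THEN notE, OF has_matching_2I]
  show "colorable E S 2"
  proof (cases "\<exists>x\<in>S. \<exists>y\<in>S. E x y")
    case False
    then show ?thesis using colorable_mono[OF colorable_1, of S S 2] by auto
  next
    case True
    then obtain x y where xy: "x \<in> S" "y \<in> S" "E x y" by blast
    define c :: "'a \<Rightarrow> nat" where
      "c v = (if E x v \<or> \<not> E y v \<and> \<not> (\<exists>u\<in>S. E x u \<and> E v u) then 1 else 0)" for v
    have side: False if "a \<in> S" "u \<in> S" "w \<in> S" "\<not> E x a" "\<not> E y a" "E x u" "E y w" "E a u" "E a w"
      for a u w
    proof -
      have "\<not> E u w" using tri[of a u w] that by blast
      moreover have "\<not> E x w" using tri[of x y w] that xy by blast
      moreover have "\<not> E y u" using tri[of x y u] that xy by blast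
      ultimately have "five_cycle a u x y w"
        unfolding five_cycle_def using that xy sym by blast
      then show False using no that xy by blast
    qed
    show ?thesis
    proof (rule colorableI[where c = c])
      show "c v < 2" for v by (simp add: c_def)
      have ne: False if uv: "u \<in> S" "v \<in> S" "E u v" "c u = c v" "E x u" for u v
      proof -
        have "\<not> E x v" using tri[of x u v] uv xy by blast
        then have "\<not> E y v" "\<not> (\<exists>u\<in>S. E x u \<and> E v u)" using uv by (auto simp: c_def split: if_splits)
        then show False using uv sym by blast
      qed
      have ne2: False if uv: "u \<in> S" "v \<in> S" "E u v" "c u = c v" "\<not> E x u" "\<not> E x v" "E y u" for u v
      proof -
        have "\<not> E y v" using tri[of y u v] uv xy by blast
        moreover have "c u = 0" using uv by (simp add: c_def)
        ultimately obtain w where "w \<in> S" "E x w" "E v w"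
          using uv by (auto simp: c_def split: if_splits)
        then show False using side[of v w u] uv sym \<open>\<not> E y v\<close> by blast
      qed
      show "c u \<noteq> c v" if uv: "u \<in> S" "v \<in> S" "E u v" for u v
      proof
        assume eq: "c u = c v"
        have "\<not> E x u" "\<not> E x v" using ne[OF uv eq] ne[OF uv(2,1) sym[OF uv(3)]] eq by auto
        moreover have "\<not> E y u" "\<not> E y v"
          using ne2[OF uv eq] ne2[OF uv(2,1) sym[OF uv(3)]] eq calculation by auto
        ultimately show False using mat[of x y u v] xy uv by blast
      qed
    qed
  qed
qed

text \<open>Meant for an edge \<open>bc\<close> of a triangle-free and 2K2-free set: two classes lie
  in neighbourhoods and the third misses the edge, so all are independent.\<close>

definition edge_color :: "'a \<Rightarrow> 'a \<Rightarrow> 'a \<Rightarrow> nat" where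
  "edge_color b c v = (if E b v then 0 else if E c v then 1 else 2)"

lemma edge_color_less: "edge_color b c v < 3"
  by (simp add: edge_color_def)

lemma edge_color_proper:
  assumes "\<not> has_clique 3 S" "\<not> has_matching 2 S" "b \<in> S" "c \<in> S" "E b c"
    and uv: "u \<in> S" "v \<in> S" "E u v"
  shows "edge_color b c u \<noteq> edge_color b c v"
  using has_clique_3I[of b S u v] has_clique_3I[of c S u v] has_matching_2I[of b S c u v] assms
  by (auto simp: edge_color_def split: if_splits)

lemma three_colorable_if_no_triangle_no_2K2:
  assumes "\<not> has_clique 3 S" "\<not> has_matching 2 S"
  shows "colorable E S 3"
proof (cases "\<exists>b\<in>S. \<exists>c\<in>S. E b c")
  case True
  then obtain b c where "b \<in> S" "c \<in> S" "E b c" by blast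
  then show ?thesis
    using edge_color_less edge_color_proper[OF assms] by (intro colorableI[where c = "edge_color b c"])
next
  case False
  then show ?thesis using colorable_mono[OF colorable_1, of S S 3] by auto
qed

lemma to_pattern_eqs:
  "to_pattern [[], [0], [1], [2], [0,3], [0,1,2,3,4]] = [[True, True, True, True, True],
     [True, False, False, True], [True, False, False], [True, False], [True], []]"
  "to_pattern [[], [0], [1], [2], [0,3], []] = [[False, False, False, False, False],
     [True, False, False, True], [True, False, False], [True, False], [True], []]"
  "to_pattern [[], [0], [0,1], []] = [[False, False, False], [True, True], [True], []]"
  "to_pattern [[], [0], [1], [2], [0,3], [], [5], []] =
     [[False, False, False, False, False, False, False],
      [True, False, False, False, False, False], [False, False, False, False, False],
      [True, False, False, True], [True, False, False], [True, False], [True], []]"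
  by code_simp+

text \<open>
  These are the 5-wheel, the 5-cycle plus an isolated vertex and the triangle plus an isolated
  vertex. Without them both the neighbours and the non-neighbours of a vertex induce bipartite
  graphs.
\<close>

lemma K4_2K2_steps_targets:
  "{to_pattern [[], [0], [1], [2], [0,3], [0,1,2,3,4]], to_pattern [[], [0], [1], [2], [0,3], []],
    to_pattern [[], [0], [0,1], []]} \<subseteq> fst ` set K4_2K2_steps"
  by (simp add: K4_2K2_steps_def)

theorem four_colorable_if_no_K4_no_2K2:
  assumes "finite S" and K4: "\<not> has_clique 4 S" and M2S: "\<not> has_matching 2 S"
  shows "colorable E S 4"
proof (rule ccontr)
  assume "\<not> ?thesis"
  then obtain T where T: "T \<subseteq> S" "critical E T 4"
    using not_colorable_imp_critical_subset[OF assms(1)] by blast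
  have K4T: "\<not> has_clique 4 T" and M2T: "\<not> has_matching 2 T"
    using K4 M2S T(1) has_clique_mono has_matching_mono by blast+
  interpret refutation E T K4_2K2_adj K4_2K2_non
    using refutation_K4_2K2[OF T(2) K4T M2T] .
  have "\<forall>p \<in> fst ` set K4_2K2_steps. \<not> occurs E T p"
    using refutes_sound[OF K4_2K2_steps_refute] by (auto simp: avoids_def)
  then have avoid: "\<not> occurs E T (to_pattern [[], [0], [1], [2], [0,3], [0,1,2,3,4]])"
      "\<not> occurs E T (to_pattern [[], [0], [1], [2], [0,3], []])"
      "\<not> occurs E T (to_pattern [[], [0], [0,1], []])"
    using K4_2K2_steps_targets by blast+
  have "T \<noteq> {}" using T(2) unfolding critical_def colorable_def by auto
  then obtain v where v: "v \<in> T" by blast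
  let ?N = "{x \<in> T. E v x}" and ?M = "{x \<in> T. \<not> E v x}"
  have N3: "\<not> has_clique 3 ?N" using not_has_clique_neighbours[of 3 T v ?N] K4T v by auto
  have N2: "\<not> has_matching 2 ?N" and M2: "\<not> has_matching 2 ?M"
    using M2T has_matching_mono[of 2 _ T] by blast+
  have M3: "\<not> has_clique 3 ?M"
  proof
    assume "has_clique 3 ?M"
    then obtain a b c where "a \<in> ?M" "b \<in> ?M" "c \<in> ?M" "E a b" "E a c" "E b c"
      unfolding numeral_3_eq_3 by auto
    then have "realizes E T (to_pattern [[], [0], [0,1], []]) [v, c, b, a]"
      unfolding to_pattern_eqs using v irrefl adj_commute[of b a] adj_commute[of c a] adj_commute[of c b]
      by auto
    then show False using avoid(3) by (auto simp: occurs_def)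
  qed
  have N5: "\<not> five_cycle a b c d e" if "a \<in> ?N" "b \<in> ?N" "c \<in> ?N" "d \<in> ?N" "e \<in> ?N" for a b c d e
  proof
    assume "five_cycle a b c d e"
    then have "realizes E T (to_pattern [[], [0], [1], [2], [0,3], [0,1,2,3,4]]) [v, e, d, c, b, a]"
      unfolding to_pattern_eqs using five_cycle_realizes[of a b c d e T] v that irrefl by auto
    then show False using avoid(1) by (auto simp: occurs_def)
  qed
  have M5: "\<not> five_cycle a b c d e" if "a \<in> ?M" "b \<in> ?M" "c \<in> ?M" "d \<in> ?M" "e \<in> ?M" for a b c d e
  proof
    assume "five_cycle a b c d e"
    then have "realizes E T (to_pattern [[], [0], [1], [2], [0,3], []]) [v, e, d, c, b, a]"
      unfolding to_pattern_eqs using five_cycle_realizes[of a b c d e T] v that irrefl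
      adj_commute[of a b] by auto
    then show False using avoid(2) by (auto simp: occurs_def)
  qed
  have "colorable E ?N 2" using two_colorable_or_five_cycle[OF N3 N2] N5 by blast
  moreover have "colorable E ?M 2" using two_colorable_or_five_cycle[OF M3 M2] M5 by blast
  ultimately have "colorable E T 4" by (rule colorable_cover) auto
  then show False using T(2) unfolding critical_def by blast
qed

text \<open>
  Without a copy of C5 + K2 + K1, the vertices missing an edge xy either induce a bipartite graph or
  a blow-up of a 5-cycle. In a 3-colouring of the latter every neighbour of y sees at most two
  colours, so that only the neighbours of x need a fourth one.
\<close>

lemma K3_3K2_steps_target:
  "to_pattern [[], [0], [1], [2], [0,3], [], [5], []] \<in> fst ` set K3_3K2_steps"
  by (simp add: K3_3K2_steps_def)

theorem four_colorable_if_no_K3_no_3K2: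
  assumes "finite S" and K3: "\<not> has_clique 3 S" and M3: "\<not> has_matching 3 S"
  shows "colorable E S 4"
proof (rule ccontr)
  assume "\<not> ?thesis"
  then obtain T where T: "T \<subseteq> S" "critical E T 4"
    using not_colorable_imp_critical_subset[OF assms(1)] by blast
  have K3T: "\<not> has_clique 3 T" and M3T: "\<not> has_matching 3 T"
    using K3 M3 T(1) has_clique_mono has_matching_mono by blast+
  have not4: "\<not> colorable E T 4" using T(2) unfolding critical_def by blast
  interpret refutation E T K3_3K2_adj K3_3K2_non
    using refutation_K3_3K2[OF T(2) K3T M3T] .
  have "\<forall>p \<in> fst ` set K3_3K2_steps. \<not> occurs E T p"
    using refutes_sound[OF K3_3K2_steps_refute] by (auto simp: avoids_def)
  then have avoid: "\<not> occurs E T (to_pattern [[], [0], [1], [2], [0,3], [], [5], []])"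
    using K3_3K2_steps_target by blast
  have tri: "\<lbrakk>p \<in> T; q \<in> T; r \<in> T; E p q; E p r; E q r\<rbrakk> \<Longrightarrow> False" for p q r
    by (rule K3T[THEN notE], rule has_clique_3I)
  obtain x y where xy: "x \<in> T" "y \<in> T" "E x y"
    using not4 colorable_mono[OF colorable_1, of T T 4] by fastforce
  let ?A = "{v \<in> T. \<not> E x v \<and> \<not> E y v}" and ?X = "{v \<in> T. E x v}" and ?Y = "{v \<in> T. E y v}"
  have K3A: "\<not> has_clique 3 ?A" using K3T has_clique_mono[of 3 ?A T] by auto
  have M2A: "\<not> has_matching 2 ?A"
    using not_has_matching_nonneighbours[of 2 T x y ?A] M3T xy by auto
  have mat: "\<lbrakk>p \<in> ?A; q \<in> ?A; r \<in> ?A; s \<in> ?A; E p q; E r s;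
      \<not> E p r; \<not> E p s; \<not> E q r; \<not> E q s\<rbrakk> \<Longrightarrow> False" for p q r s
    by (rule M2A[THEN notE], rule has_matching_2I)
  have "colorable E ?X 1" "colorable E ?Y 1"
    by (rule colorable_1, use tri[of x] tri[of y] xy in blast)+
  note XY = colorable_Un[OF this]
  have "\<not> colorable E ?A 2"
    using not4 colorable_cover[OF XY, of ?A 2 T 4] by auto
  then obtain a b c d e where A: "a \<in> ?A" "b \<in> ?A" "c \<in> ?A" "d \<in> ?A" "e \<in> ?A"
      and cyc: "five_cycle a b c d e"
    using two_colorable_or_five_cycle[OF K3A M2A] by blast
  note C = cyc[unfolded five_cycle_def]
  \<comment> \<open>A vertex without neighbours on the cycle would form C5 + K2 + K1 with it and the
    edge \<open>xy\<close>.\<close>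
  have dom: "E v a \<or> E v b \<or> E v c \<or> E v d \<or> E v e" if v: "v \<in> ?A" for v
  proof (rule ccontr)
    assume no: "\<not> ?thesis"
    have "realizes E T (to_pattern [[], [0], [1], [2], [0,3], [], [5], []]) [v, y, x, e, d, c, b, a]"
      unfolding to_pattern_eqs using five_cycle_realizes[OF cyc, of T] v A xy no irrefl
        adj_commute[of y x] adj_commute[of v x] adj_commute[of v y] C by auto
    then show False using avoid by (auto simp: occurs_def)
  qed
  let ?f = "edge_color b c"
  \<comment> \<open>The vertices \<open>p\<close>, \<open>q\<close>, \<open>r\<close> are pairwise
    non-adjacent, having the neighbour \<open>u\<close> in common. In the blow-up \<open>r\<close>
    takes the place of \<open>e\<close>, \<open>p\<close> that of \<open>a\<close> or
    \<open>c\<close>, and \<open>q\<close> that of \<open>b\<close> or \<open>d\<close>. Three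
    places on a 5-cycle include two consecutive ones, and a missing edge between those gives a
    2K2.\<close>
  have rainbow: False if u: "u \<in> T" "p \<in> ?A" "q \<in> ?A" "r \<in> ?A" "E u p" "E u q" "E u r"
      "E b p" "\<not> E b q" "E c q" "\<not> E b r" "\<not> E c r" for u p q r
  proof -
    have pqr: "\<not> E p q" "\<not> E p r" "\<not> E q r"
      using tri[of u p q] tri[of u p r] tri[of u q r] u by (auto simp: adj_commute)
    have cs: "\<not> E a p" "\<not> E c p" "\<not> E d q"
      using tri[of a b p] tri[of b c p] tri[of c d q] u A C by (auto simp: adj_commute)
    have er: "\<not> E e r" using mat[of e r b c] A u C by (auto simp: adj_commute)
    have "E a r" "E d r"
      using er dom[of r] mat[of a r c d] mat[of d r a b] A u C by (auto simp: adj_commute)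
    consider "E d p" "\<not> E e p" | "E e p" "\<not> E d p"
      using mat[of b p d e] tri[of d e p] A u C by (auto simp: adj_commute)
    then show False
    proof cases
      case 1
      consider "E a q" "\<not> E e q" | "E e q" "\<not> E a q"
        using mat[of c q a e] tri[of a e q] A u C by (auto simp: adj_commute)
      then show False
      proof cases
        case 1
        then show False using mat[of d p a q] \<open>E d p\<close> A u(1-4) u(8-) C cs pqr by (auto simp: adj_commute)
      next
        case 2
        then show False using mat[of b p e q] \<open>\<not> E e p\<close> A u(1-4) u(8-) C cs pqr by (auto simp: adj_commute)
      qed
    next
      case 2
      then show False using mat[of b p d r] \<open>E d r\<close> A u(1-4) u(8-) C cs pqr by (auto simp: adj_commute)
    qed
  qed
  \<comment> \<open>A colour absent from the neighbours of \<open>u\<close> in \<open>?A\<close>; by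
    \<open>rainbow\<close> the default 2 is absent when 0 and 1 both occur.\<close>
  define g where "g u = (if \<forall>v\<in>?A. E u v \<longrightarrow> ?f v \<noteq> 0 then 0
    else if \<forall>v\<in>?A. E u v \<longrightarrow> ?f v \<noteq> 1 then 1 else 2 :: nat)" for u
  have g: "g u \<noteq> ?f v" if u: "u \<in> T" "v \<in> ?A" "E u v" for u v
  proof
    assume eq: "g u = ?f v"
    then have "?f v = 2" "\<exists>p\<in>?A. E u p \<and> ?f p = 0" "\<exists>q\<in>?A. E u q \<and> ?f q = 1"
      using u by (auto simp: g_def split: if_splits)
    then show False using rainbow[of u _ _ v] u by (auto simp: edge_color_def split: if_splits)
  qed
  define h where "h v = (if E x v then 3 else if E y v then g v else ?f v)" for v
  have "colorable E T 4"
  proof (rule colorableI[where c = h])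
    show "h v < 4" if "v \<in> T" for v by (simp add: h_def g_def edge_color_def)
    have ne: "h u \<noteq> h v" if uv: "u \<in> T" "v \<in> T" "E u v" "E x u \<or> \<not> E x v \<and> (E y u \<or> \<not> E y v)" for u v
    proof -
      have "g w < 3" "?f w < 3" for w by (auto simp: g_def edge_color_def)
      then have lt: "g w \<noteq> 3" "?f w \<noteq> 3" for w by (metis less_irrefl)+
      consider "E x u" | "\<not> E x u" "\<not> E x v" "E y u" | "u \<in> ?A" "v \<in> ?A" using uv by blast
      then show ?thesis
      proof cases
        case 1
        then have "\<not> E x v" using tri[of x u v] uv xy by blast
        then show ?thesis using 1 lt by (auto simp: h_def)
      next
        case 2
        then have "\<not> E y v" using tri[of y u v] uv xy by blast
        then show ?thesis using 2 g[of u v] uv by (auto simp: h_def)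
      next
        case 3
        then show ?thesis using edge_color_proper[OF K3A M2A A(2,3) _ 3 uv(3)] C by (auto simp: h_def)
      qed
    qed
    show "h u \<noteq> h v" if "u \<in> T" "v \<in> T" "E u v" for u v
      using ne[OF that] ne[OF that(2,1) sym[OF that(3)]] by metis
  qed
  then show False using not4 by blast
qed

section \<open>Colouring around a maximum clique\<close>

lemma colorable_if_P3_free:
  assumes "finite S" and P3: "\<And>a b c. \<lbrakk>a \<in> S; b \<in> S; c \<in> S; E a b; E b c; a \<noteq> c\<rbrakk> \<Longrightarrow> E a c"
    and K: "\<not> has_clique (Suc k) S"
  shows "colorable E S k"
  using assms
proof (induction S rule: finite_induct)
  case empty
  show ?case by (simp add: colorable_def)
next
  case (insert v S)
  let ?N = "{x \<in> S. E v x}"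
  have IH: "colorable E S k"
    by (rule insert.IH) (use insert.prems has_clique_mono[of "Suc k" S "insert v S"] in blast)+
  \<comment> \<open>Together with \<open>v\<close> its neighbours form a clique, so they block fewer
    than \<open>k\<close> colours.\<close>
  have "E x y" if "x \<in> ?N" "y \<in> ?N" "x \<noteq> y" for x y
    using insert.prems(1)[of x v y] that sym[of v x] by auto
  then have "has_clique (card ?N) ?N" using insert.hyps(1) by (intro has_cliqueI[of ?N]) auto
  then have "has_clique (Suc (card ?N)) (insert v S)"
    using has_clique_mono[of "card ?N" ?N "{x \<in> insert v S. E v x}"] by auto
  then have "card ?N < k"
    using has_clique_le[of "Suc (card ?N)" "insert v S" "Suc k"] insert.prems(2) by linarith
  then show ?case using colorable_insert[OF insert.hyps IH] by blast
qed

text \<open>The diamond is K4 - e, which is what the neighbourhood of a vertex of full degree in K5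
  - e looks like.\<close>

definition diamond_free :: "'a set \<Rightarrow> bool" where
  "diamond_free S \<longleftrightarrow> (\<forall>x\<in>S. \<forall>y\<in>S. \<forall>a\<in>S. \<forall>b\<in>S.
     E x y \<and> E x a \<and> E y a \<and> E x b \<and> E y b \<and> a \<noteq> b \<longrightarrow> E a b)"

definition K5e_free :: "'a set \<Rightarrow> bool" where
  "K5e_free S \<longleftrightarrow> (\<forall>x\<in>S. \<forall>y\<in>S. \<forall>z\<in>S. \<forall>a\<in>S. \<forall>b\<in>S. E x y \<and> E x z \<and> E y z \<and>
     E x a \<and> E y a \<and> E z a \<and> E x b \<and> E y b \<and> E z b \<and> a \<noteq> b \<longrightarrow> E a b)"

lemma diamond_freeD:
  "\<lbrakk>diamond_free S; x \<in> S; y \<in> S; a \<in> S; b \<in> S; E x y; E x a; E y a; E x b; E y b; a \<noteq> b\<rbrakk> \<Longrightarrow> E a b"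
  unfolding diamond_free_def by blast

lemma K5e_freeD:
  "\<lbrakk>K5e_free S; x \<in> S; y \<in> S; z \<in> S; a \<in> S; b \<in> S; E x y; E x z; E y z;
    E x a; E y a; E z a; E x b; E y b; E z b; a \<noteq> b\<rbrakk> \<Longrightarrow> E a b"
  unfolding K5e_free_def by blast

lemma diamond_free_mono:
  assumes "diamond_free S" "T \<subseteq> S"
  shows "diamond_free T"
  unfolding diamond_free_def
proof (intro ballI impI)
  show "E a b" if "x \<in> T" "y \<in> T" "a \<in> T" "b \<in> T"
      "E x y \<and> E x a \<and> E y a \<and> E x b \<and> E y b \<and> a \<noteq> b" for x y a b
    using diamond_freeD[OF assms(1), of x y a b] that assms(2) by auto
qed

lemma K5e_free_mono:
  assumes "K5e_free S" "T \<subseteq> S"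
  shows "K5e_free T"
  unfolding K5e_free_def
proof (intro ballI impI)
  show "E a b" if "x \<in> T" "y \<in> T" "z \<in> T" "a \<in> T" "b \<in> T" "E x y \<and> E x z \<and> E y z \<and>
      E x a \<and> E y a \<and> E z a \<and> E x b \<and> E y b \<and> E z b \<and> a \<noteq> b" for x y z a b
    using K5e_freeD[OF assms(1), of x y z a b] that assms(2) by auto
qed

lemma diamond_free_neighbours:
  assumes "K5e_free S" "v \<in> S" and T: "\<And>x. x \<in> T \<Longrightarrow> x \<in> S \<and> E v x"
  shows "diamond_free T"
  unfolding diamond_free_def
proof (intro ballI impI)
  show "E a b" if "x \<in> T" "y \<in> T" "a \<in> T" "b \<in> T"
      "E x y \<and> E x a \<and> E y a \<and> E x b \<and> E y b \<and> a \<noteq> b" for x y a b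
    using K5e_freeD[OF assms(1,2), of x y a b] that T[of x] T[of y] T[of a] T[of b] by auto
qed

text \<open>Two neighbours \<open>a\<close>, \<open>c\<close> of \<open>b\<close> inside the
  neighbourhood of \<open>v\<close> are common neighbours of the edge \<open>vb\<close>, hence
  adjacent: the neighbourhood is a disjoint union of cliques.\<close>

lemma colorable_if_P3_free_neighbours:
  assumes "finite S" "diamond_free S" "\<not> has_clique (Suc (Suc k)) S" "v \<in> S"
    and T: "\<And>x. x \<in> T \<Longrightarrow> x \<in> S \<and> E v x"
  shows "colorable E T k"
proof (rule colorable_if_P3_free)
  show "finite T" using assms(1) T by (auto intro: finite_subset[of T S])
  show "E a c" if "a \<in> T" "b \<in> T" "c \<in> T" "E a b" "E b c" "a \<noteq> c" for a b c
    using diamond_freeD[OF assms(2,4), of b a c] T[of a] T[of b] T[of c] that sym[of a b] by auto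
  show "\<not> has_clique (Suc k) T"
    using not_has_clique_neighbours[OF assms(3,4) T] by blast
qed

text \<open>By maximality a vertex outside misses some vertex of the clique and can take the colour
  of that vertex.\<close>

lemma colorable_if_independent_outside_clique:
  assumes K: "K \<subseteq> S" "finite K" "\<forall>x\<in>K. \<forall>y\<in>K. x \<noteq> y \<longrightarrow> E x y"
    and max: "\<not> has_clique (Suc (card K)) S"
    and out: "\<And>u v. \<lbrakk>u \<in> S - K; v \<in> S - K\<rbrakk> \<Longrightarrow> \<not> E u v"
  shows "colorable E S (card K)"
proof -
  obtain h where h: "bij_betw h K {..<card K}"
    using K(2) by (metis atLeast0LessThan ex_bij_betw_finite_nat)
  have ex: "\<exists>z\<in>K. \<not> E u z" if "u \<in> S - K" for u
  proof (rule ccontr)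
    assume no: "\<not> ?thesis"
    have "has_clique (Suc (card K)) S"
      by (rule has_cliqueI[of "insert u K"]) (use K no that sym in auto)
    then show False using max by blast
  qed
  define z where "z u = (if u \<in> K then u else SOME z. z \<in> K \<and> \<not> E u z)" for u
  have z: "z u \<in> K" "\<not> E u (z u)" if "u \<in> S" for u
    using someI_ex[of "\<lambda>z. z \<in> K \<and> \<not> E u z"] ex[of u] that irrefl by (auto simp: z_def)
  show ?thesis
  proof (rule colorableI[where c = "\<lambda>u. h (z u)"])
    show "h (z u) < card K" if "u \<in> S" for u
      using h z(1)[OF that] by (auto simp: bij_betw_def)
    show "h (z u) \<noteq> h (z v)" if "u \<in> S" "v \<in> S" "E u v" for u v
    proof
      assume "h (z u) = h (z v)"
      then have eq: "z u = z v"
        using h z(1) that by (auto simp: bij_betw_def dest: inj_onD)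
      have "u \<in> K \<or> v \<in> K" using out[of u v] that by blast
      then show False
        using eq z(2)[OF that(1)] z(2)[OF that(2)] that(3) sym[OF that(3)] by (auto simp: z_def split: if_splits)
    qed
  qed
qed

lemma card_ge_2_clique_edge:
  assumes "finite L" "2 \<le> card L" "\<forall>x\<in>L. \<forall>y\<in>L. x \<noteq> y \<longrightarrow> E x y"
  shows "\<exists>x\<in>L. \<exists>y\<in>L. E x y"
proof -
  obtain x y where "x \<in> L" "y \<in> L" "x \<noteq> y"
    using assms(2) by (metis One_nat_def card_le_Suc0_iff_eq assms(1) not_less_eq_eq numeral_2_eq_2)
  then show ?thesis using assms(3) by blast
qed

text \<open>Two vertices of the clique missed by both \<open>u\<close> and \<open>v\<close> would
  form a 2K2 with the edge \<open>uv\<close>.\<close>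

lemma not_adjacent_if_missing_clique_edge:
  assumes M2: "\<not> has_matching 2 S"
    and K: "K \<subseteq> S" "finite K" "\<forall>x\<in>K. \<forall>y\<in>K. x \<noteq> y \<longrightarrow> E x y"
    and uv: "u \<in> S" "v \<in> S" and few: "card ({x \<in> K. E u x} \<union> {x \<in> K. E v x}) + 2 \<le> card K"
  shows "\<not> E u v"
proof
  assume "E u v"
  let ?L = "K - ({x \<in> K. E u x} \<union> {x \<in> K. E v x})"
  have "2 \<le> card ?L"
    using few diff_card_le_card_Diff[of "{x \<in> K. E u x} \<union> {x \<in> K. E v x}" K] K(2) by auto
  then have "\<exists>x\<in>?L. \<exists>y\<in>?L. E x y"
    by (intro card_ge_2_clique_edge) (use K(2,3) in auto)
  then obtain x y where "x \<in> ?L" "y \<in> ?L" "E x y" by blast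
  then have "has_matching 2 S"
    using uv K(1) \<open>E u v\<close> by (intro has_matching_2I[of u S v x y]) auto
  then show False using M2 by blast
qed

lemma independent_outside_clique:
  assumes M2: "\<not> has_matching 2 S"
    and K: "K \<subseteq> S" "finite K" "\<forall>x\<in>K. \<forall>y\<in>K. x \<noteq> y \<longrightarrow> E x y"
    and few: "\<And>u. u \<in> S - K \<Longrightarrow> card {x \<in> K. E u x} \<le> d" and d: "2 * d + 2 \<le> card K"
    and uv: "u \<in> S - K" "v \<in> S - K"
  shows "\<not> E u v"
proof (rule not_adjacent_if_missing_clique_edge[OF M2 K])
  show "card ({x \<in> K. E u x} \<union> {x \<in> K. E v x}) + 2 \<le> card K"
    using card_Un_le[of "{x \<in> K. E u x}" "{x \<in> K. E v x}"] few[OF uv(1)] few[OF uv(2)] d by linarith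
qed (use uv in auto)

text \<open>Both \<open>u\<close> and any further vertex of the clique are common neighbours of the
  edge \<open>xy\<close>, so they are adjacent; \<open>u\<close> would then enlarge the
  clique.\<close>

lemma clique_neighbours_diamond_free:
  assumes D: "diamond_free S" and K: "K \<subseteq> S" "finite K" "\<forall>x\<in>K. \<forall>y\<in>K. x \<noteq> y \<longrightarrow> E x y"
    and max: "\<not> has_clique (Suc (card K)) S" and u: "u \<in> S - K"
    and xy: "x \<in> K" "y \<in> K" "x \<noteq> y" "E u x" "E u y"
  shows False
proof -
  have "E u z" if z: "z \<in> K" for z
  proof (cases "z = x \<or> z = y")
    case False
    moreover have "u \<noteq> z" using u z by blast
    ultimately show ?thesis
      using diamond_freeD[OF D, of x y u z] K(3) subsetD[OF K(1), of x] subsetD[OF K(1), of y]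
        subsetD[OF K(1), of z] u xy z sym[OF xy(4)] sym[OF xy(5)] by auto
  qed (use xy in auto)
  then have "has_clique (Suc (card K)) S"
    by (intro has_cliqueI[of "insert u K"]) (use K u sym in auto)
  then show False using max by blast
qed

lemma clique_neighbours_K5e_free:
  assumes D: "K5e_free S" and K: "K \<subseteq> S" "finite K" "\<forall>x\<in>K. \<forall>y\<in>K. x \<noteq> y \<longrightarrow> E x y"
    and max: "\<not> has_clique (Suc (card K)) S" and u: "u \<in> S - K"
    and xyz: "x \<in> K" "y \<in> K" "z \<in> K" "x \<noteq> y" "x \<noteq> z" "y \<noteq> z" "E u x" "E u y" "E u z"
  shows False
proof -
  have "E u w" if w: "w \<in> K" for w
  proof (cases "w = x \<or> w = y \<or> w = z")
    case False
    moreover have "u \<noteq> w" using u w by blast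
    ultimately show ?thesis
      using K5e_freeD[OF D, of x y z u w] K(3) subsetD[OF K(1), of x] subsetD[OF K(1), of y]
        subsetD[OF K(1), of z] subsetD[OF K(1), of w] u xyz w sym[OF xyz(7)] sym[OF xyz(8)]
        sym[OF xyz(9)] by auto
  qed (use xyz in auto)
  then have "has_clique (Suc (card K)) S"
    by (intro has_cliqueI[of "insert u K"]) (use K u sym in auto)
  then show False using max by blast
qed

lemma card_le_if_no_triple:
  assumes "finite L" "\<And>x y z. \<lbrakk>x \<in> L; y \<in> L; z \<in> L; x \<noteq> y; x \<noteq> z; y \<noteq> z\<rbrakk> \<Longrightarrow> False"
  shows "card L \<le> 2"
proof (rule ccontr)
  assume "\<not> ?thesis"
  then obtain M where "M \<subseteq> L" "card M = 3" by (metis not_less_eq_eq numeral_2_eq_2 numeral_3_eq_3 obtain_subset_with_card_n)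
  then obtain x y z where "M = {x, y, z}" "x \<noteq> y" "x \<noteq> z" "y \<noteq> z" by (auto simp: card_3_iff)
  then show False using assms(2)[of x y z] \<open>M \<subseteq> L\<close> by auto
qed

lemma colorable_diamond_free_2K2_free:
  assumes "finite S" and M2: "\<not> has_matching 2 S" and D: "diamond_free S"
    and cl: "has_clique m S" and max: "\<not> has_clique (Suc m) S" and "3 \<le> m"
  shows "colorable E S m"
proof -
  obtain K where K: "K \<subseteq> S" "finite K" "card K = m" "\<forall>x\<in>K. \<forall>y\<in>K. x \<noteq> y \<longrightarrow> E x y"
    using cl by (rule has_cliqueE)
  have max': "\<not> has_clique (Suc (card K)) S" using max K(3) by simp
  have one: False if "u \<in> S - K" "x \<in> K" "y \<in> K" "x \<noteq> y" "E u x" "E u y" for u x y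
    using clique_neighbours_diamond_free[OF D K(1,2,4) max' that] .
  show ?thesis
  proof (cases "m = 3")
    case False
    have few: "card {x \<in> K. E u x} \<le> 1" if "u \<in> S - K" for u
    proof -
      have "\<forall>x\<in>{x \<in> K. E u x}. \<forall>y\<in>{x \<in> K. E u x}. x = y" using one[OF that] by blast
      then show ?thesis using K(2) card_le_Suc0_iff_eq[of "{x \<in> K. E u x}"] by auto
    qed
    have "\<not> E u v" if "u \<in> S - K" "v \<in> S - K" for u v
      by (rule independent_outside_clique[OF M2 K(1,2,4) few _ that]) (use K(3) False \<open>3 \<le> m\<close> in auto)
    then show ?thesis
      using colorable_if_independent_outside_clique[OF K(1,2,4) max'] K(3) by auto
  next
    case True
    then obtain x y z where xyz: "K = {x, y, z}" "x \<noteq> y" "x \<noteq> z" "y \<noteq> z"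
      using K(3) by (auto simp: card_3_iff)
    have S: "x \<in> S" "y \<in> S" "z \<in> S" and e: "E x y" "E x z" "E y z" "E y x" "E z x" "E z y"
      using K(1,4) xyz by auto
    \<comment> \<open>A vertex outside sees at most one of \<open>x\<close>, \<open>y\<close>,
      \<open>z\<close>. Seeing \<open>x\<close> gives the colour of \<open>y\<close>, seeing
      \<open>y\<close> that of \<open>z\<close>, and the others take that of \<open>x\<close>; in
      each class all outside vertices miss a common edge of the triangle, so they are
      independent.\<close>
    define c :: "'a \<Rightarrow> nat" where "c v = (if v = x then 0 else if v = y then 1 else if v = z then 2
      else if E v x then 1 else if E v y then 2 else 0)" for v
    have out: "\<not> (E u x \<and> E u y)" "\<not> (E u x \<and> E u z)" "\<not> (E u y \<and> E u z)" if "u \<in> S - K" for u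
      using one[OF that] xyz by auto
    have mat: False if "u \<in> S" "v \<in> S" "E u v" "a \<in> S" "b \<in> S" "E a b"
        "\<not> E u a" "\<not> E u b" "\<not> E v a" "\<not> E v b" for u v a b
      using M2 has_matching_2I[of u S v a b] that by blast
    show ?thesis
    proof (rule colorableI[where c = c])
      show "c v < m" for v using True by (simp add: c_def)
      have ne: "c u \<noteq> c v" if uv: "u \<in> S - K" "v \<in> S" "E u v" for u v
      proof (cases "v \<in> K")
        case True
        then show ?thesis using out[OF uv(1)] uv xyz by (auto simp: c_def)
      next
        case False
        then show ?thesis
          using uv out[OF uv(1)] out[of v] xyz S e mat[of u v y z] mat[of u v x z] mat[of u v x y]
          by (auto simp: c_def split: if_splits)
      qed
      have neK: "c u \<noteq> c v" if "u \<in> K" "v \<in> K" "E u v" for u v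
        using that xyz irrefl by (auto simp: c_def)
      show "c u \<noteq> c v" if "u \<in> S" "v \<in> S" "E u v" for u v
        using ne[of u v] ne[of v u] neK[of u v] that sym[OF that(3)]
        by (cases "u \<in> K"; cases "v \<in> K") auto
    qed
  qed
qed

text \<open>A vertex outside sees at most two vertices of the K4 and so misses one of its six edges;
  the vertices missing a given edge are independent. The four clique vertices are absorbed by the
  classes of the edges of a 4-cycle, one each.\<close>

lemma colorable_K5e_free_2K2_free_4:
  assumes "finite S" and M2: "\<not> has_matching 2 S" and D: "K5e_free S"
    and cl: "has_clique 4 S" and max: "\<not> has_clique 5 S"
  shows "colorable E S 6"
proof -
  obtain K where K: "K \<subseteq> S" "finite K" "card K = 4" "\<forall>x\<in>K. \<forall>y\<in>K. x \<noteq> y \<longrightarrow> E x y"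
    using cl by (rule has_cliqueE)
  have max': "\<not> has_clique (Suc (card K)) S" using max K(3) by simp
  obtain xs where xs: "set xs = K" "distinct xs" "length xs = 4"
    using finite_distinct_list[OF K(2)] distinct_card K(3) by metis
  then obtain a b c d where "xs = [a, b, c, d]" by (auto simp: numeral_eq_Suc length_Suc_conv)
  then have abcd: "K = {a, b, c, d}" "distinct [a, b, c, d]" using xs by auto
  have S: "a \<in> S" "b \<in> S" "c \<in> S" "d \<in> S" using K(1) abcd by auto
  have e: "E a b" "E a c" "E a d" "E b c" "E b d" "E c d" using K(4) abcd by auto
  have out: "\<not> (E u x \<and> E u y \<and> E u z)"
    if "u \<in> S - K" "x \<in> K" "y \<in> K" "z \<in> K" "x \<noteq> y" "x \<noteq> z" "y \<noteq> z" for u x y z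
    using clique_neighbours_K5e_free[OF D K(1,2,4) max' that] by blast
  define J where "J x y = {v \<in> S. \<not> E v x \<and> \<not> E v y}" for x y
  have J: "colorable E (J x y) 1" if "x \<in> S" "y \<in> S" "E x y" for x y
  proof (rule colorable_1)
    show "\<not> E u v" if "u \<in> J x y" "v \<in> J x y" for u v
      using M2 has_matching_2I[of u S v x y] that \<open>x \<in> S\<close> \<open>y \<in> S\<close> \<open>E x y\<close> by (auto simp: J_def)
  qed
  have J': "colorable E (insert x (J x y)) 1" if "x \<in> S" "y \<in> S" "E x y" for x y
    by (rule colorable_insert_isolated[OF J[OF that]]) (auto simp: J_def dest: sym)
  have cover: "v \<in> insert a (J a b) \<union> insert b (J b c) \<union> (insert c (J c d) \<union> insert d (J d a)) \<union>
      (J a c \<union> J b d)" if "v \<in> S" for v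
  proof (cases "v \<in> K")
    case False
    then show ?thesis
      using out[of v a b c] out[of v a b d] out[of v a c d] out[of v b c d] that abcd
      by (auto simp: J_def)
  qed (use abcd in auto)
  have "colorable E (insert a (J a b) \<union> insert b (J b c) \<union> (insert c (J c d) \<union> insert d (J d a)) \<union>
      (J a c \<union> J b d)) (1 + 1 + (1 + 1) + (1 + 1))"
    by (intro colorable_Un J J' S e sym[OF e(3)])
  then show ?thesis by (rule colorable_mono) (use cover in auto)
qed

lemma colorable_K5e_free_2K2_free_5:
  assumes "finite S" and M2: "\<not> has_matching 2 S" and D: "K5e_free S"
    and cl: "has_clique m S" and max: "\<not> has_clique (Suc m) S" and "5 \<le> m"
  shows "colorable E S m"
proof -
  obtain K where K: "K \<subseteq> S" "finite K" "card K = m" "\<forall>x\<in>K. \<forall>y\<in>K. x \<noteq> y \<longrightarrow> E x y"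
    using cl by (rule has_cliqueE)
  have max': "\<not> has_clique (Suc (card K)) S" using max K(3) by simp
  have out: "\<not> (E u x \<and> E u y \<and> E u z)"
    if "u \<in> S - K" "x \<in> K" "y \<in> K" "z \<in> K" "x \<noteq> y" "x \<noteq> z" "y \<noteq> z" for u x y z
    using clique_neighbours_K5e_free[OF D K(1,2,4) max' that] by blast
  have few: "card {x \<in> K. E u x} \<le> 2" if "u \<in> S - K" for u
    by (rule card_le_if_no_triple) (use out[OF that] K(2) in auto)
  show ?thesis
  proof (cases "m = 5")
    case False
    have "\<not> E u v" if "u \<in> S - K" "v \<in> S - K" for u v
      by (rule independent_outside_clique[OF M2 K(1,2,4) few _ that]) (use K(3) False \<open>5 \<le> m\<close> in auto)
    then show ?thesis
      using colorable_if_independent_outside_clique[OF K(1,2,4) max'] K(3) by auto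
  next
    case True
    obtain xs where xs: "set xs = K" "distinct xs" "length xs = 5"
      using finite_distinct_list[OF K(2)] distinct_card K(3) True by metis
    then obtain k1 k2 k3 k4 k5 where "xs = [k1, k2, k3, k4, k5]"
      by (auto simp: numeral_eq_Suc length_Suc_conv)
    then have k: "K = {k1, k2, k3, k4, k5}" "distinct [k1, k2, k3, k4, k5]" using xs by auto
    have S: "k1 \<in> S" "k2 \<in> S" "k3 \<in> S" "k4 \<in> S" "k5 \<in> S" using K(1) k by auto
    have e: "E x y" if "x \<in> K" "y \<in> K" "x \<noteq> y" for x y using K(4) that by blast
    \<comment> \<open>Adjacent vertices outside must see disjoint pairs of clique vertices, since
      otherwise both miss an edge. So a class is safe if its members share a neighbour
      (\<open>k5\<close> for colours 1 and 2, \<open>k1\<close> for 4) or all miss the edge between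
      \<open>k1\<close> and \<open>k5\<close> (colour 0). Seeing \<open>k2\<close> and
      \<open>k5\<close> excludes seeing \<open>k3\<close>, which frees colour 2.\<close>
    define c :: "'a \<Rightarrow> nat" where "c v = (if v = k1 then 0 else if v = k2 then 1 else if v = k3 then 2
      else if v = k4 then 3 else if v = k5 then 4 else
      if E v k5 then (if E v k2 then 2 else 1) else if E v k1 then 4 else 0)" for v
    have mat: False if "u \<in> S" "v \<in> S" "E u v" "a \<in> K" "b \<in> K" "a \<noteq> b"
        "\<not> E u a" "\<not> E u b" "\<not> E v a" "\<not> E v b" for u v a b
      using M2 has_matching_2I[of u S v a b] that e[of a b] K(1) by auto
    show ?thesis
    proof (rule colorableI[where c = c])
      show "c v < m" for v using True by (simp add: c_def)
      have ne: "c u \<noteq> c v" if uv: "u \<in> S - K" "v \<in> K" "E u v" for u v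
        using out[OF uv(1), of k2 k5 k3] uv k by (auto simp: c_def split: if_splits)
      have ne2: "c u \<noteq> c v" if uv: "u \<in> S - K" "v \<in> S - K" "E u v" for u v
      proof
        assume eq: "c u = c v"
        consider z where "z \<in> K" "E u z" "E v z" | "\<not> E u k5" "\<not> E v k5" "\<not> E u k1" "\<not> E v k1"
          using eq uv k by (auto simp: c_def split: if_splits)
        then show False
        proof cases
          case 1
          let ?A = "{x \<in> K. E u x}" and ?B = "{x \<in> K. E v x}"
          have "card (?A \<inter> ?B) > 0" using 1 K(2) by (auto simp: card_gt_0_iff)
          then have "card (?A \<union> ?B) + 2 \<le> card K"
            using card_Un_Int[of ?A ?B] few[OF uv(1)] few[OF uv(2)] K(2,3) True by auto
          then show False
            using not_adjacent_if_missing_clique_edge[OF M2 K(1,2,4), of u v] uv by blast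
        next
          case 2
          then show ?thesis using mat[of u v k1 k5] uv k by auto
        qed
      qed
      have cK: "c k1 = 0" "c k2 = 1" "c k3 = 2" "c k4 = 3" "c k5 = 4" using k(2) by (auto simp: c_def)
      have neK: "c u \<noteq> c v" if uv: "u \<in> K" "v \<in> K" "E u v" for u v
      proof -
        have "u \<noteq> v" using uv(3) irrefl by blast
        then show ?thesis using uv(1,2) unfolding k(1) by (auto simp: cK)
      qed
      show "c u \<noteq> c v" if "u \<in> S" "v \<in> S" "E u v" for u v
        using ne[of u v] ne[of v u] ne2[of u v] neK[of u v] that sym[OF that(3)]
        by (cases "u \<in> K"; cases "v \<in> K") auto
    qed
  qed
qed

end

section \<open>The recursive bounds\<close>

lemma gbound_0: "gbound p 0 = 0"
  by (subst gbound.simps) simp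

lemma fbound_0: "fbound p 0 = 0"
  by (subst fbound.simps) simp

lemma gbound_mono: "2 \<le> p \<Longrightarrow> gbound p m \<le> gbound p (Suc m)"
proof (induction p rule: nat_induct_at_least)
  case base
  consider "m = 0" | "m = 1" | "m = 2" | "m \<ge> 3" by linarith
  then show ?case using gbound_eqs(1,2) gbound_eqs(3)[of m] gbound_eqs(3)[of "Suc m"]
    by cases (auto simp: gbound_0 numeral_2_eq_2 numeral_3_eq_3)
next
  case (Suc p)
  have *: "gbound (Suc p) 3 = gbound p 3 + 4" using gbound_eqs(5)[of "Suc p" 3] Suc.hyps by simp
  have "2 * p - 2 \<le> gbound p 3 \<and> 3 \<le> gbound p 3"
    using Suc.hyps
  proof (induction p rule: nat_induct_at_least)
    case (Suc p)
    then show ?case using gbound_eqs(5)[of "Suc p" 3] by auto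
  qed (simp add: gbound_eqs)
  then have 23: "gbound (Suc p) 2 \<le> gbound (Suc p) 3"
    using gbound_eqs(4)[of "Suc p"] Suc.hyps * by auto
  consider "m = 0" | "m = 1" | "m = 2" | "m \<ge> 3" by linarith
  then show ?case
  proof cases
    case 4
    then show ?thesis
      using Suc.IH gbound_eqs(5)[of "Suc p" m] gbound_eqs(5)[of "Suc p" "Suc m"] Suc.hyps by auto
  qed (use 23 gbound_eqs(1)[of "Suc p"] gbound_eqs(4)[of "Suc p"] Suc.hyps in
      \<open>auto simp: gbound_0 numeral_2_eq_2 numeral_3_eq_3\<close>)
qed

text \<open>The closed form at 3 obeys the recursion as well: it grows by 4p - 1 = 2(2p - 2) + 3
  from p to p + 1, and at the start 13 = 4 + 2 * 3 + 3. One inductive step thus serves all clique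
  numbers from 3 on.\<close>

lemma fbound_rec:
  assumes "2 \<le> p" "3 \<le> m"
  shows "fbound (Suc p) m = fbound p m + 2 * gbound p (m - 1) + (3 * m - 6)"
proof (cases "m = 3")
  case True
  have "int (fbound (Suc p) 3) = int (fbound p 3) + 2 * int (gbound p 2) + 3"
  proof (cases "p = 2")
    case True
    then show ?thesis using fbound_eqs(3) fbound_eqs(7)[of 3] gbound_eqs(2) by simp
  next
    case False
    then have p: "3 \<le> p" using assms by simp
    then have "int (gbound p 2) = 2 * int p - 2" using gbound_eqs(4)[of p] by (simp add: of_nat_diff)
    then show ?thesis using fbound_eqs(7)[of p] fbound_eqs(7)[of "Suc p"] p
      by (simp add: power2_eq_square algebra_simps)
  qed
  then show ?thesis using True by simp
next
  case False
  then show ?thesis using fbound_eqs(8)[of "Suc p" m] assms by simp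
qed

text \<open>The sequence \<open>fbound 2\<close> runs 0, 1, 3, 4, 6, 5, 6, 7 and so on; its only
  descent is from 4 to 5.\<close>

lemma fbound_2_le: "i \<le> m \<Longrightarrow> m \<noteq> 5 \<Longrightarrow> fbound 2 i \<le> fbound 2 m"
  by (subst (1 2) fbound.simps) auto

lemma fbound_2_le_6: "i \<le> 5 \<Longrightarrow> fbound 2 i \<le> 6"
  by (subst fbound.simps) auto

lemma fbound_mono_Suc: "3 \<le> p \<Longrightarrow> fbound p m \<le> fbound p (Suc m)"
proof (induction p rule: nat_induct_at_least)
  case base
  have rec: "fbound 3 k = fbound 2 k + 2 * gbound 2 (k - 1) + (3 * k - 6)" if "3 \<le> k" for k
    using fbound_rec[of 2 k] that by (simp add: numeral_eq_Suc)
  have v: "fbound 3 1 = 1" "fbound 3 2 = 4" using fbound_eqs(1,6) by auto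
  have v3: "fbound 3 3 = 13" "fbound 3 4 = 18"
    using rec[of 3] rec[of 4] gbound_eqs(2) gbound_eqs(3)[of 3] fbound_eqs(3,4) by auto
  have v5: "fbound 3 k = 6 * k - 8" if "5 \<le> k" for k
    using rec[of k] gbound_eqs(3)[of "k - 1"] fbound_eqs(5)[of k] that by auto
  consider "m = 0" | "m = 1" | "m = 2" | "m = 3" | "m = 4" | "5 \<le> m" by linarith
  then show ?case
    using v v3 v5[of m] v5[of "Suc m"] by cases (auto simp: fbound_0 eval_nat_numeral)
next
  case (Suc p)
  have "2 * p \<le> fbound (Suc p) 3"
  proof -
    have "3 * int p \<le> int p * int p" using Suc.hyps by (intro mult_right_mono) auto
    moreover have "int (fbound (Suc p) 3) = 2 * (int p * int p) + int p + 3"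
      using fbound_eqs(7)[of "Suc p"] Suc.hyps by (simp add: power2_eq_square algebra_simps)
    ultimately have "int (2 * p) \<le> int (fbound (Suc p) 3)" by linarith
    then show ?thesis by linarith
  qed
  then have 23: "fbound (Suc p) 2 \<le> fbound (Suc p) 3" using fbound_eqs(6)[of "Suc p"] Suc.hyps by simp
  consider "m = 0" | "m = 1" | "m = 2" | "3 \<le> m" by linarith
  then show ?case
  proof cases
    case 4
    then show ?thesis
      using Suc.IH Suc.hyps fbound_rec[of p m] fbound_rec[of p "Suc m"] gbound_mono[of p "m - 1"] by auto
  qed (use 23 fbound_eqs(1)[of "Suc p"] fbound_eqs(6)[of "Suc p"] Suc.hyps in
      \<open>auto simp: fbound_0 numeral_2_eq_2 numeral_3_eq_3\<close>)
qed

lemma fbound_mono: "3 \<le> p \<Longrightarrow> i \<le> m \<Longrightarrow> fbound p i \<le> fbound p m"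
  using fbound_mono_Suc by (rule lift_Suc_mono_le)

section \<open>Induction on the number of independent edges\<close>

context graph_rel begin

declare has_clique.simps(2) [simp del] has_matching.simps(2) [simp del]

lemma colorable_0: "\<not> has_clique 1 S \<Longrightarrow> colorable E S 0"
  by (auto simp: colorable_def has_clique.simps)

lemma colorable_1_if_no_edge: "\<not> has_clique 2 S \<Longrightarrow> colorable E S 1"
  by (rule colorable_1) (auto simp: numeral_2_eq_2 has_clique.simps)

lemma colorable_edge_partition:
  assumes "colorable E {v \<in> S. \<not> E x v \<and> \<not> E y v} k"
    and "colorable E {v \<in> S. E x v} l" "colorable E {v \<in> S. E y v} l"
  shows "colorable E S (k + 2 * l)"
  by (rule colorable_cover[OF assms(1) colorable_Un[OF assms(2,3)]]) auto

lemma colorable_gbound_2: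
  assumes "finite S" "\<not> has_matching 2 S" "diamond_free S" "\<not> has_clique (Suc m) S"
  shows "colorable E S (gbound 2 m)"
  using assms(4)
proof (induction m)
  case 0
  then show ?case using colorable_0 by (simp add: gbound_0)
next
  case (Suc k)
  consider "k = 0" | "k = 1" | "k \<ge> 2" by linarith
  then show ?case
  proof cases
    case 1
    then show ?thesis
      using Suc.prems colorable_1_if_no_edge[of S] gbound_eqs(1)[of 2] by (simp add: numeral_2_eq_2)
  next
    case 2
    then show ?thesis
      using Suc.prems three_colorable_if_no_triangle_no_2K2[OF _ assms(2)] gbound_eqs(2)
      by (simp add: numeral_2_eq_2 numeral_3_eq_3)
  next
    case 3
    show ?thesis
    proof (cases "has_clique (Suc k) S")
      case True
      then show ?thesis
        using colorable_diamond_free_2K2_free[OF assms(1-3) True Suc.prems] 3 gbound_eqs(3)[of "Suc k"]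
        by simp
    next
      case False
      then show ?thesis using colorable_mono[OF Suc.IH, of S] gbound_mono[of 2 k] by simp
    qed
  qed
qed

text \<open>In a diamond-free graph the whole neighbourhood of a vertex is a disjoint union of
  cliques, so an edge takes the role of the triangle and each of its ends costs \<open>m - 1\<close>
  colours.\<close>

theorem colorable_gbound:
  assumes "2 \<le> p" "finite S" "\<not> has_matching p S" "diamond_free S" "\<not> has_clique (Suc m) S"
  shows "colorable E S (gbound p m)"
  using assms
proof (induction p arbitrary: S m rule: nat_induct_at_least)
  case base
  then show ?case using colorable_gbound_2 by blast
next
  case (Suc p)
  \<comment> \<open>Triangle-free and 3K2-free graphs stand apart: the recursion would give 3 + 2
    colours where \<open>gbound 3 2 = 4\<close>. From there on the values at 2 grow by 2 and obey
    it.\<close>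
  consider "m = 0" | "m = 1" | "m = 2" "p = 2" | "m \<ge> 2" "m \<noteq> 2 \<or> p \<noteq> 2" by linarith
  then show ?case
  proof cases
    case 1
    then show ?thesis using Suc.prems colorable_0 by (simp add: gbound_0)
  next
    case 2
    then show ?thesis
      using Suc.prems colorable_1_if_no_edge[of S] gbound_eqs(1)[of "Suc p"] by (simp add: numeral_2_eq_2)
  next
    case 3
    then show ?thesis
      using Suc.prems four_colorable_if_no_K3_no_3K2[of S] gbound_eqs(4)[of 3] by (simp add: eval_nat_numeral)
  next
    case 4
    have rec: "gbound (Suc p) m = gbound p m + 2 * (m - 1)"
      using 4 gbound_eqs(4)[of "Suc p"] gbound_eqs(4)[of p] gbound_eqs(5)[of "Suc p" m] Suc.hyps
      by (cases "m = 2") auto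
    show ?thesis
    proof (cases "\<exists>x\<in>S. \<exists>y\<in>S. E x y")
      case False
      then have "colorable E S 1" by (intro colorable_1) auto
      then show ?thesis using colorable_mono[of E S 1 S "gbound (Suc p) m"] rec 4(1) by auto
    next
      case True
      then obtain x y where xy: "x \<in> S" "y \<in> S" "E x y" by blast
      let ?A = "{v \<in> S. \<not> E x v \<and> \<not> E y v}"
      have "\<not> has_matching p ?A"
        using not_has_matching_nonneighbours[OF Suc.prems(2) xy, of ?A] by auto
      moreover have "\<not> has_clique (Suc m) ?A" using Suc.prems(4) has_clique_mono[of "Suc m" ?A S] by auto
      moreover have "diamond_free ?A" using diamond_free_mono[OF Suc.prems(3), of ?A] by auto
      ultimately have "colorable E ?A (gbound p m)" using Suc.IH[of ?A m] Suc.prems(1) by auto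
      moreover have "colorable E {v \<in> S. E z v} (m - 1)" if "z \<in> S" for z
        using colorable_if_P3_free_neighbours[OF Suc.prems(1,3) _ that, of "m - 1" "{v \<in> S. E z v}"]
          Suc.prems(4) 4(1)
        by auto
      ultimately show ?thesis unfolding rec using colorable_edge_partition xy by blast
    qed
  qed
qed

lemma clique_number_below:
  assumes "\<not> has_clique (Suc m) S"
  shows "\<exists>i\<le>m. has_clique i S \<and> \<not> has_clique (Suc i) S"
  using assms
proof (induction m)
  case (Suc m)
  then show ?case by (cases "has_clique (Suc m) S") (auto intro: le_SucI)
qed simp

text \<open>The neighbourhood of \<open>x\<close> is diamond-free, and the neighbourhood of
  \<open>y\<close> inside it is then a disjoint union of cliques. Each passage lowers the clique
  number by one.\<close>

lemma colorable_common_neighbours: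
  assumes "finite S" "K5e_free S" "\<not> has_clique (Suc m) S" "3 \<le> m" "x \<in> S" "y \<in> S" "E x y"
    and T: "\<And>v. v \<in> T \<Longrightarrow> v \<in> S \<and> E x v \<and> E y v"
  shows "colorable E T (m - 2)"
proof (rule colorable_if_P3_free_neighbours[of "{v \<in> S. E x v}" _ y])
  show "diamond_free {v \<in> S. E x v}" by (rule diamond_free_neighbours[OF assms(2,5)]) auto
  show "\<not> has_clique (Suc (Suc (m - 2))) {v \<in> S. E x v}"
    using not_has_clique_neighbours[OF assms(3,5), of "{v \<in> S. E x v}"] assms(4) by (simp add: numeral_2_eq_2 Suc_diff_Suc)
qed (use assms in auto)

text \<open>Missing the edge \<open>yz\<close> costs \<open>T\<close> a matching edge; lying in the
  neighbourhood of \<open>x\<close> makes it diamond-free and lowers its clique number.\<close>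

lemma colorable_private_neighbours:
  assumes "2 \<le> p" "finite S" "\<not> has_matching (Suc p) S" "K5e_free S" "\<not> has_clique (Suc m) S" "3 \<le> m"
    and "x \<in> S" "y \<in> S" "z \<in> S" "E y z" and T: "\<And>v. v \<in> T \<Longrightarrow> v \<in> S \<and> E x v \<and> \<not> E y v \<and> \<not> E z v"
  shows "colorable E T (gbound p (m - 1))"
proof (rule colorable_gbound[OF assms(1)])
  show "finite T" using assms(2) T by (auto intro: finite_subset[of T S])
  show "\<not> has_matching p T"
    using not_has_matching_nonneighbours[OF assms(3,8,9,10)] T by blast
  show "diamond_free T" using diamond_free_neighbours[OF assms(4,7)] T by blast
  show "\<not> has_clique (Suc (m - 1)) T"
    using not_has_clique_neighbours[OF assms(5,7)] T assms(6) by simp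
qed

text \<open>The private neighbours of \<open>z\<close> miss \<open>xy\<close> and fall into the
  first set, which leaves two private sets and three sets of common neighbours. The bound
  \<open>k\<close> stays open because \<open>fbound 2\<close> is not monotone.\<close>

lemma colorable_fbound_step:
  assumes p: "2 \<le> p" and fin: "finite S" and M: "\<not> has_matching (Suc p) S" and D: "K5e_free S"
    and cl: "has_clique m S" and max: "\<not> has_clique (Suc m) S" and m: "3 \<le> m"
    and F: "\<And>T. T \<subseteq> S \<Longrightarrow> \<not> has_matching p T \<Longrightarrow> colorable E T k"
  shows "colorable E S (k + 2 * gbound p (m - 1) + (3 * m - 6))"
proof -
  have "has_clique 3 S" using has_clique_le[OF cl m] .
  then obtain x y z where S: "x \<in> S" "y \<in> S" "z \<in> S" and e: "E x y" "E x z" "E y z"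
    unfolding numeral_3_eq_3 has_clique.simps by blast
  have "colorable E {v \<in> S. \<not> E x v \<and> \<not> E y v} k"
    by (rule F, blast, rule not_has_matching_nonneighbours[OF M S(1,2) e(1)]) blast
  moreover have "colorable E {v \<in> S. E x v \<and> \<not> E y v \<and> \<not> E z v} (gbound p (m - 1))"
    by (rule colorable_private_neighbours[OF p fin M D max m S e(3)]) auto
  moreover have "colorable E {v \<in> S. E y v \<and> \<not> E x v \<and> \<not> E z v} (gbound p (m - 1))"
    by (rule colorable_private_neighbours[OF p fin M D max m S(2,1,3) e(2)]) auto
  moreover have "colorable E {v \<in> S. E x v \<and> E y v} (m - 2)"
    by (rule colorable_common_neighbours[OF fin D max m S(1,2) e(1)]) auto
  moreover have "colorable E {v \<in> S. E x v \<and> E z v} (m - 2)"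
    by (rule colorable_common_neighbours[OF fin D max m S(1,3) e(2)]) auto
  moreover have "colorable E {v \<in> S. E y v \<and> E z v} (m - 2)"
    by (rule colorable_common_neighbours[OF fin D max m S(2,3) e(3)]) auto
  ultimately have "colorable E ({v \<in> S. \<not> E x v \<and> \<not> E y v} \<union>
      ({v \<in> S. E x v \<and> \<not> E y v \<and> \<not> E z v} \<union> {v \<in> S. E y v \<and> \<not> E x v \<and> \<not> E z v}) \<union>
      ({v \<in> S. E x v \<and> E y v} \<union> ({v \<in> S. E x v \<and> E z v} \<union> {v \<in> S. E y v \<and> E z v})))
      (k + (gbound p (m - 1) + gbound p (m - 1)) + (m - 2 + (m - 2 + (m - 2))))"
    by (intro colorable_Un)
  then show ?thesis by (rule colorable_mono) (use m in auto)
qed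

text \<open>
  In a 3K2-free graph with clique number 5 the vertices missing an edge may need 6 colours, one
  more than the recursion grants. A whole 5-clique xyzab makes up for this: the common neighbours
  of x, z or of y, z outside the clique miss the edge ab, so that 4 colours suffice for them.
\<close>

lemma colorable_fbound_step_3_5:
  assumes fin: "finite S" and M: "\<not> has_matching 3 S" and D: "K5e_free S"
    and cl: "has_clique 5 S" and max: "\<not> has_clique 6 S"
    and F: "\<And>T. T \<subseteq> S \<Longrightarrow> \<not> has_matching 2 T \<Longrightarrow> colorable E T 6"
  shows "colorable E S 22"
proof -
  obtain K where K: "K \<subseteq> S" "finite K" "card K = 5" "\<forall>x\<in>K. \<forall>y\<in>K. x \<noteq> y \<longrightarrow> E x y"
    using cl by (rule has_cliqueE)
  obtain xs where xs: "set xs = K" "distinct xs" "length xs = 5"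
    using finite_distinct_list[OF K(2)] distinct_card K(3) by metis
  then obtain x y z a b where "xs = [x, y, z, a, b]"
    by (auto simp: numeral_eq_Suc length_Suc_conv)
  then have k: "K = {x, y, z, a, b}" "distinct [x, y, z, a, b]" using xs by auto
  have S: "x \<in> S" "y \<in> S" "z \<in> S" "a \<in> S" "b \<in> S" using K(1) k by auto
  have e: "E x y" "E x z" "E y z" "E a b" using K(4) k by auto
  have M': "\<not> has_matching (Suc 2) S" and max': "\<not> has_clique (Suc 5) S" "\<not> has_clique (Suc (card K)) S"
    using M max K(3) by simp_all
  have g4: "gbound 2 (5 - 1) = 4" using gbound_eqs(3)[of 4] by simp
  let ?X = "{v \<in> S. E x v \<and> \<not> E y v \<and> \<not> E z v}" and ?Y = "{v \<in> S. E y v \<and> \<not> E x v \<and> \<not> E z v}"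
  \<comment> \<open>Vertices seeing both \<open>x\<close> and \<open>y\<close> are already counted,
    so this set replaces two sets with three colours each by one with four. As \<open>x\<close> and
    \<open>y\<close> see \<open>a\<close> and \<open>b\<close>, they are taken out and moved to the
    private neighbours of the other one, to none of which they are adjacent.\<close>
  let ?Z = "{v \<in> S. E z v \<and> (E x v \<and> \<not> E y v \<or> E y v \<and> \<not> E x v)} - {x, y}"
  have A: "colorable E {v \<in> S. \<not> E x v \<and> \<not> E y v} 6"
    by (rule F, blast, rule not_has_matching_nonneighbours[OF M' S(1,2) e(1)]) blast
  have "colorable E ?X 4"
    using colorable_private_neighbours[OF order_refl fin M' D max'(1) _ S(1-3) e(3), of ?X] g4 by auto
  then have X: "colorable E (insert y ?X) 4"
    by (rule colorable_insert_isolated) auto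
  have "colorable E ?Y 4"
    using colorable_private_neighbours[OF order_refl fin M' D max'(1) _ S(2,1,3) e(2), of ?Y] g4 by auto
  then have Y: "colorable E (insert x ?Y) 4"
    by (rule colorable_insert_isolated) auto
  have C: "colorable E {v \<in> S. E x v \<and> E y v} 3"
    using colorable_common_neighbours[OF fin D max'(1) _ S(1,2) e(1), of "{v \<in> S. E x v \<and> E y v}"] by auto
  have Z: "v \<in> S \<and> E z v \<and> \<not> E a v \<and> \<not> E b v" if v: "v \<in> ?Z" for v
  proof -
    have "v \<in> S - K" using v k K(4) by auto
    note out = clique_neighbours_K5e_free[OF D K(1,2,4) max'(2) this]
    show ?thesis
      using v k out[of x z a] out[of x z b] out[of y z a] out[of y z b] by (auto simp: adj_commute)
  qed
  have "3 \<le> (5 :: nat)" by simp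
  from colorable_private_neighbours[OF order_refl fin M' D max'(1) this S(3-5) e(4) Z]
  have "colorable E ?Z 4" unfolding g4 .
  then have "colorable E ({v \<in> S. \<not> E x v \<and> \<not> E y v} \<union> (insert y ?X \<union> insert x ?Y) \<union>
      ({v \<in> S. E x v \<and> E y v} \<union> ?Z)) (6 + (4 + 4) + (3 + 4))"
    using A X Y C by (intro colorable_Un)
  then show ?thesis by (rule colorable_mono) auto
qed

lemma colorable_fbound_2:
  assumes "finite S" "\<not> has_matching 2 S" "K5e_free S" "has_clique m S" "\<not> has_clique (Suc m) S"
  shows "colorable E S (fbound 2 m)"
proof -
  consider "m = 0" | "m = 1" | "m = 2" | "m = 3" | "m = 4" | "5 \<le> m" by linarith
  then show ?thesis
  proof cases
    case 1
    then show ?thesis using assms colorable_0 by (simp add: fbound_0)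
  next
    case 2
    then show ?thesis using assms colorable_1_if_no_edge[of S] fbound_eqs(1)[of 2] by (simp add: numeral_2_eq_2)
  next
    case 3
    then show ?thesis using assms three_colorable_if_no_triangle_no_2K2[of S] fbound_eqs(2) by simp
  next
    case 4
    then show ?thesis using assms four_colorable_if_no_K4_no_2K2[of S] fbound_eqs(3) by simp
  next
    case 5
    then show ?thesis using assms colorable_K5e_free_2K2_free_4[of S] fbound_eqs(4) by simp
  next
    case 6
    then show ?thesis using assms colorable_K5e_free_2K2_free_5[of S m] fbound_eqs(5)[of m] by simp
  qed
qed

theorem colorable_fbound:
  assumes "2 \<le> p" "finite S" "\<not> has_matching p S" "K5e_free S" "has_clique m S" "\<not> has_clique (Suc m) S"
  shows "colorable E S (fbound p m)"
  using assms
proof (induction p arbitrary: S m rule: nat_induct_at_least)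
  case base
  then show ?case using colorable_fbound_2 by blast
next
  case (Suc p)
  have below: "\<exists>i\<le>m. colorable E T (fbound p i)" if T: "T \<subseteq> S" "\<not> has_matching p T" for T
  proof -
    have "\<not> has_clique (Suc m) T" using Suc.prems(5) T(1) has_clique_mono by blast
    then obtain i where "i \<le> m" "has_clique i T" "\<not> has_clique (Suc i) T"
      using clique_number_below by blast
    moreover have "finite T" "K5e_free T"
      using Suc.prems(1,3) T(1) K5e_free_mono finite_subset by blast+
    ultimately show ?thesis using Suc.IH[of T i] T(2) by blast
  qed
  consider "m = 0" | "m = 1" | "m = 2" | "p = 2" "m = 5" | "3 \<le> m" "p \<noteq> 2 \<or> m \<noteq> 5" by linarith
  then show ?case
  proof cases
    case 1
    then show ?thesis using Suc.prems colorable_0 by (simp add: fbound_0)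
  next
    case 2
    then show ?thesis
      using Suc.prems colorable_1_if_no_edge[of S] fbound_eqs(1)[of "Suc p"] by (simp add: numeral_2_eq_2)
  next
    case 3
    \<comment> \<open>A diamond contains a triangle, and both bounds agree at clique number
      2.\<close>
    then have K3: "\<not> has_clique 3 S" using Suc.prems(5) by simp
    have "diamond_free S"
      unfolding diamond_free_def
    proof (intro ballI impI)
      show "E c d" if "x \<in> S" "y \<in> S" "c \<in> S" "d \<in> S"
        "E x y \<and> E x c \<and> E y c \<and> E x d \<and> E y d \<and> c \<noteq> d" for x y c d
        using K3 has_clique_3I[of x S y c] that by auto
    qed
    then have "colorable E S (gbound (Suc p) 2)"
      using colorable_gbound[of "Suc p" S 2] Suc.prems Suc.hyps 3 by simp
    then show ?thesis using 3 gbound_eqs(4)[of "Suc p"] fbound_eqs(6)[of "Suc p"] Suc.hyps by simp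
  next
    case 4
    have "colorable E T 6" if "T \<subseteq> S" "\<not> has_matching 2 T" for T
    proof -
      have "\<exists>i\<le>5. colorable E T (fbound 2 i)" using below[of T] that 4 by simp
      then obtain i where i: "i \<le> 5" "colorable E T (fbound 2 i)" by blast
      show ?thesis by (rule colorable_mono[OF i(2) subset_refl fbound_2_le_6[OF i(1)]])
    qed
    moreover have "\<not> has_matching 3 S" "has_clique 5 S" "\<not> has_clique 6 S" using Suc.prems 4 by simp_all
    ultimately have "colorable E S 22"
      using colorable_fbound_step_3_5[OF Suc.prems(1) _ Suc.prems(3)] by blast
    moreover have "fbound 3 5 = 22"
      using fbound_rec[of 2 5] gbound_eqs(3)[of 4] fbound_eqs(5)[of 5] by simp
    ultimately show ?thesis using 4 by simp
  next
    case 5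
    have "colorable E T (fbound p m)" if T: "T \<subseteq> S" "\<not> has_matching p T" for T
    proof -
      obtain i where i: "i \<le> m" "colorable E T (fbound p i)" using below[OF T] by blast
      have "fbound p i \<le> fbound p m"
        using fbound_2_le[of i m] fbound_mono[of p i m] i(1) 5(2) Suc.hyps by (cases "p = 2") auto
      then show ?thesis using colorable_mono[OF i(2)] by blast
    qed
    from colorable_fbound_step[OF Suc.hyps Suc.prems(1-5) 5(1) this]
    show ?thesis using fbound_rec[OF Suc.hyps 5(1)] by simp
  qed
qed

end

section \<open>From digraphs to adjacency relations\<close>

lemma induced_copy_if_embedding:
  assumes G: "wf_digraph (with_proj G)" and H: "wf_digraph (with_proj H)"
    and inj: "inj_on f (pverts H)" and sub: "f ` pverts H \<subseteq> pverts G"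
    and arcs: "\<And>i j. i \<in> pverts H \<Longrightarrow> j \<in> pverts H \<Longrightarrow> (f i, f j) \<in> parcs G \<longleftrightarrow> (i, j) \<in> parcs H"
  shows "\<exists>K. induced_subgraph K (with_proj G) \<and> digraph_iso K (with_proj H)"
proof -
  interpret H: wf_digraph "with_proj H" by (rule H)
  let ?V = "f ` pverts H"
  let ?K = "\<lparr>verts = ?V, arcs = {e \<in> parcs G. fst e \<in> ?V \<and> snd e \<in> ?V}, tail = fst, head = snd\<rparr>
    :: ('a, 'a \<times> 'a) pre_digraph"
  \<comment> \<open>The isomorphism has to lead from the copy to \<open>H\<close>, against the
    direction of \<open>f\<close>.\<close>
  let ?g = "the_inv_into (pverts H) f"
  have wfK: "wf_digraph ?K" by unfold_locales auto
  have ind: "induced_subgraph ?K (with_proj G)"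
    unfolding induced_subgraph_def subgraph_def compatible_def using sub G wfK by auto
  have gf: "?g (f i) = i" if "i \<in> pverts H" for i using the_inv_into_f_f[OF inj that] .
  have img: "map_prod ?g ?g ` {e \<in> parcs G. fst e \<in> ?V \<and> snd e \<in> ?V} = parcs H"
  proof (intro set_eqI iffI)
    fix e assume "e \<in> map_prod ?g ?g ` {e \<in> parcs G. fst e \<in> ?V \<and> snd e \<in> ?V}"
    then show "e \<in> parcs H" using arcs gf by auto
  next
    fix e assume e: "e \<in> parcs H"
    obtain i j where ij: "e = (i, j)" by (cases e)
    then have "i \<in> pverts H" "j \<in> pverts H" using H.wellformed[of e] e by auto
    then show "e \<in> map_prod ?g ?g ` {e \<in> parcs G. fst e \<in> ?V \<and> snd e \<in> ?V}"
      using arcs gf e ij by (intro image_eqI[of _ _ "(f i, f j)"]) auto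
  qed
  let ?iso = "\<lparr>iso_verts = ?g, iso_arcs = map_prod ?g ?g, iso_head = snd, iso_tail = fst\<rparr>
    :: ('a, 'a \<times> 'a, 'b, 'b \<times> 'b) digraph_isomorphism"
  have injg: "inj_on ?g ?V" using inj_on_the_inv_into[OF inj] .
  have "inj_on (map_prod ?g ?g) (arcs ?K)"
    by (rule inj_on_subset[OF map_prod_inj_on[OF injg injg]]) auto
  then have "pre_digraph.digraph_isomorphism ?K ?iso"
    unfolding pre_digraph.digraph_isomorphism_def using wfK injg by auto
  moreover have "with_proj H = app_iso ?iso ?K"
    unfolding app_iso_def with_proj_def using img the_inv_into_onto[OF inj] by simp
  ultimately show ?thesis using ind unfolding digraph_iso_def by blast
qed

lemma wf_pK2: "wf_digraph (with_proj (pK2 p))"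
  by unfold_locales (auto simp: pK2_def)

lemma wf_K5_minus_e: "wf_digraph (with_proj K5_minus_e)"
  by unfold_locales (auto simp: K5_minus_e_def)

text \<open>The edge split off takes the indices \<open>2 * k\<close> and \<open>2 * k + 1\<close>,
  so that \<open>div 2\<close> identifies the edges.\<close>

lemma (in graph_rel) has_matching_embedding:
  "has_matching k S \<Longrightarrow> \<exists>f :: nat \<Rightarrow> 'a. (\<forall>i<2 * k. f i \<in> S) \<and>
     (\<forall>i<2 * k. \<forall>j<2 * k. E (f i) (f j) \<longleftrightarrow> i \<noteq> j \<and> i div 2 = j div 2)"
proof (induction k arbitrary: S)
  case (Suc k)
  then obtain a b where ab: "a \<in> S" "b \<in> S" "E a b" "has_matching k {x \<in> S. \<not> E a x \<and> \<not> E b x}"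
    by (auto simp: has_matching.simps)
  obtain f :: "nat \<Rightarrow> 'a" where f: "\<forall>i<2 * k. f i \<in> {x \<in> S. \<not> E a x \<and> \<not> E b x}"
      "\<forall>i<2 * k. \<forall>j<2 * k. E (f i) (f j) \<longleftrightarrow> i \<noteq> j \<and> i div 2 = j div 2"
    using Suc.IH[OF ab(4)] by blast
  define h where "h i = (if i < 2 * k then f i else if i = 2 * k then a else b)" for i
  have "h i \<in> S" if "i < 2 * Suc k" for i using f(1) ab by (auto simp: h_def)
  moreover have "E (h i) (h j) \<longleftrightarrow> i \<noteq> j \<and> i div 2 = j div 2" if ij: "i < 2 * Suc k" "j < 2 * Suc k" for i j
  proof -
    have new: "i = 2 * k \<or> i = 2 * k + 1" if "\<not> i < 2 * k" "i < 2 * Suc k" for i using that by auto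
    have old: "i div 2 \<noteq> k" if "i < 2 * k" for i using that by auto
    consider "i < 2 * k" "j < 2 * k" | "i < 2 * k" "\<not> j < 2 * k" | "\<not> i < 2 * k" "j < 2 * k"
      | "\<not> i < 2 * k" "\<not> j < 2 * k" by blast
    then show ?thesis
    proof cases
      case 1
      then show ?thesis using f(2) by (simp add: h_def)
    next
      case 2
      then have "\<not> E (f i) a" "\<not> E (f i) b" "j div 2 = k"
        using f(1) new[of j] ij adj_commute[of "f i"] by auto
      then show ?thesis using 2 old[of i] by (auto simp: h_def)
    next
      case 3
      then have "\<not> E a (f j)" "\<not> E b (f j)" "i div 2 = k" using f(1) new[of i] ij by auto
      then show ?thesis using 3 old[of j] by (auto simp: h_def)
    next
      case 4
      then show ?thesis using new[of i] new[of j] ij ab(3) irrefl sym[OF ab(3)] by (auto simp: h_def)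
    qed
  qed
  ultimately show ?case by blast
qed simp

theorem theorem3p7:
  fixes G :: "'a pair_pre_digraph" and p :: nat
  assumes "p \<ge> 2"
    and "pair_graph G"
    and "family_free {pK2 p, K5_minus_e} G"
  shows "chromatic_number G \<le> fbound p (clique_number G)"
proof -
  interpret G: pair_graph G by (rule assms(2))
  define E where "E u v \<longleftrightarrow> (u, v) \<in> parcs G" for u v
  let ?V = "pverts G"
  have wfG: "wf_digraph (with_proj G)" by (rule G.wf_digraph_axioms)
  have sym: "E v u" if "E u v" for u v
    using G.pair_sym_arcs that unfolding E_def symmetric_def sym_def by simp
  interpret graph_rel E
  proof
    show "E y x" if "E x y" for x y using sym[OF that] .
    show "\<not> E x x" for x using G.pair_no_loops[of "(x, x)"] unfolding E_def by auto
  qed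
  have fin: "finite ?V" by (rule G.pair_finite_verts)
  have copy: "\<not> (\<exists>K. induced_subgraph K (with_proj G) \<and> digraph_iso K (with_proj H))"
    if "H \<in> {pK2 p, K5_minus_e}" for H
    using assms(3) that unfolding family_free_def by blast
  have M: "\<not> has_matching p ?V"
  proof
    assume "has_matching p ?V"
    then obtain f :: "nat \<Rightarrow> 'a" where f: "\<forall>i<2 * p. f i \<in> ?V"
        "\<forall>i<2 * p. \<forall>j<2 * p. E (f i) (f j) \<longleftrightarrow> i \<noteq> j \<and> i div 2 = j div 2"
      using has_matching_embedding by blast
    \<comment> \<open>The adjacencies force injectivity: if \<open>i'\<close> is the partner of
      \<open>i\<close>, then \<open>f j = f i\<close> is adjacent to \<open>f i'\<close>, so
      \<open>j\<close> belongs to the same pair as \<open>i\<close>; the two members of a pair have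
      adjacent, hence different images.\<close>
    have "inj_on f {..<2 * p}"
    proof (rule inj_onI)
      fix i j assume ij: "i \<in> {..<2 * p}" "j \<in> {..<2 * p}" "f i = f j"
      define i' where "i' = (if even i then i + 1 else i - 1)"
      have i': "i' < 2 * p" "i' \<noteq> i" "i' div 2 = i div 2"
        using ij(1) by (auto simp: i'_def elim!: evenE oddE)
      then have "E (f i) (f i')" using f(2) ij(1) by auto
      then have "i div 2 = j div 2" using f(2) i' ij by auto
      moreover have "\<not> E (f i) (f j)" using ij(3) irrefl by simp
      moreover have "E (f i) (f j) \<longleftrightarrow> i \<noteq> j \<and> i div 2 = j div 2" using f(2) ij(1,2) by simp
      ultimately show "i = j" by blast
    qed
    then have "\<exists>K. induced_subgraph K (with_proj G) \<and> digraph_iso K (with_proj (pK2 p))"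
      using f by (intro induced_copy_if_embedding[OF wfG wf_pK2, of f]) (auto simp: pK2_def E_def)
    then show False using copy by blast
  qed
  have D: "K5e_free ?V"
    unfolding K5e_free_def
  proof (intro ballI impI, rule ccontr)
    fix x y z a b
    assume V: "x \<in> ?V" "y \<in> ?V" "z \<in> ?V" "a \<in> ?V" "b \<in> ?V"
      and e: "E x y \<and> E x z \<and> E y z \<and> E x a \<and> E y a \<and> E z a \<and> E x b \<and> E y b \<and> E z b \<and> a \<noteq> b"
      and ab: "\<not> E a b"
    \<comment> \<open>The non-adjacent vertices come first, as the edge removed in
      \<open>K5_minus_e\<close> joins 0 and 1.\<close>
    define f where "f = (!) [a, b, x, y, z]"
    have five: "pverts K5_minus_e = {0, 1, 2, 3, 4}" by (auto simp: K5_minus_e_def)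
    have f: "f 0 = a" "f (Suc 0) = b" "f 2 = x" "f 3 = y" "f 4 = z" by (simp_all add: f_def)
    have d: "distinct [a, b, x, y, z]" using e irrefl by auto
    have s: "E y x" "E z x" "E z y" "E a x" "E a y" "E a z" "E b x" "E b y" "E b z" "\<not> E b a"
      using e ab sym by blast+
    have "\<exists>K. induced_subgraph K (with_proj G) \<and> digraph_iso K (with_proj K5_minus_e)"
    proof (rule induced_copy_if_embedding[OF wfG wf_K5_minus_e])
      show "inj_on f (pverts K5_minus_e)" unfolding five using d by (auto simp: inj_on_def f)
      show "f ` pverts K5_minus_e \<subseteq> ?V" unfolding five using V by (auto simp: f)
      show "(f i, f j) \<in> parcs G \<longleftrightarrow> (i, j) \<in> parcs K5_minus_e"
        if "i \<in> pverts K5_minus_e" "j \<in> pverts K5_minus_e" for i j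
        using that e s ab irrefl unfolding five E_def[symmetric]
        by (auto simp: f K5_minus_e_def)
    qed
    then show False using copy by blast
  qed
  have cliques: "clique_in G K \<longleftrightarrow> K \<subseteq> ?V \<and> (\<forall>x\<in>K. \<forall>y\<in>K. x \<noteq> y \<longrightarrow> E x y)" for K
    unfolding clique_in_def E_def ..
  have finC: "finite {K. clique_in G K}"
    by (rule finite_subset[of _ "Pow ?V"]) (use fin in \<open>auto simp: clique_in_def\<close>)
  have "{} \<in> {K. clique_in G K}" by (simp add: clique_in_def)
  then have "clique_number G \<in> card ` {K. clique_in G K}"
    unfolding clique_number_def using finC by (intro Max_in) auto
  then obtain K where K: "clique_in G K" "card K = clique_number G" by auto
  then have "has_clique (clique_number G) ?V"
    using fin by (intro has_cliqueI[of K]) (auto simp: cliques intro: finite_subset)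
  moreover have "\<not> has_clique (Suc (clique_number G)) ?V"
  proof
    assume "has_clique (Suc (clique_number G)) ?V"
    then obtain L where L: "L \<subseteq> ?V" "finite L" "card L = Suc (clique_number G)"
        "\<forall>x\<in>L. \<forall>y\<in>L. x \<noteq> y \<longrightarrow> E x y" by (rule has_cliqueE)
    then have "L \<in> {K. clique_in G K}" by (simp add: cliques)
    then have "card L \<le> clique_number G"
      unfolding clique_number_def by (intro Max_ge finite_imageI finC imageI)
    then show False using L(3) by simp
  qed
  ultimately have "colorable E ?V (fbound p (clique_number G))"
    using colorable_fbound[OF assms(1) fin M D] by blast
  then obtain c where "proper_coloring G (fbound p (clique_number G)) c"
    using G.in_arcsD1 G.in_arcsD2 unfolding colorable_def proper_coloring_def E_def by blast
  then show ?thesis unfolding chromatic_number_def by (intro Least_le) blast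
qed

end
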